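(* Let $p(n)$ denote the number of partitions of $n$ (with $p(0)=1$ and $p(n)=0$ for $n<0$), and let $\sigma(n)$ be the sum of the positive divisors of $n$ (with $\sigma(n)=0$ for $n\le 0$). For an integer $k\ge 1$, define $p^{*k}(n)$ and $\sigma^{*k}(n)$ by \[ \sum_{n\ge 0} p^{*k}(n)X^n=\Big(\sum_{n\ge 0}p(n)X^n\Big)^k,\qquad \sum_{n\ge 0} \sigma^{*k}(n)X^n=\Big(\sum_{n\ge 1}\sigma(n)X^n\Big)^k . \] Then: (i) For $q\in\{5,7,11\}$, the pairs $(k,r)$ with $0<k<q$ and $0\le r<q$ such that $p^{*k}(qn+r)\equiv 0 \pmod q$ for all integers $n\ge 0$ are exactly: for $q=5$: $(1,4),(2,2),(2,3),(2,4),(4,3),(4,4)$; for $q=7$: $(1,5),(4,2),(4,4),(4,5),(4,6),(6,3),(6,4),(6,6)$; for $q=11$: $(1,6),(3,7),(5,8),(7,9),(8,2),(8,4),(8,5),(8,7),(8,8),(8,9),(10,3),(10,6),(10,8),(10,9),(10,10)$. (ii) $p^{*13}(17n+14)\equiv 0\pmod{17}$ for all integers $n\ge 0$. (iii) For $q\in\{5,7\}$, the pairs $(k,r)$ with $0<k<q$ and $0\le r<q$ such that $\sigma^{*k}(qn+r)\equiv 0\pmod q$ for all integers $n\ge 0$ are exactly: for $q=5$: $(2,1),(3,1),(3,2),(4,1),(4,2),(4,3)$; for $q=7$: $(2,6),(4,3),(4,6),(5,3)$.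
   Context: $p^{*k}$ is the $k$-fold (discrete) self-convolution of the partition function (the multipartition function), and $\sigma^{*k}$ is the $k$-fold self-convolution of the divisor function, i.e. $\sigma^{*k}(n)=\sum_{a_1+\dots+a_k=n,\ a_i\ge 0}\sigma(a_1)\cdots\sigma(a_k)$. *)

theory Defs
  imports
    "HOL-Library.Multiset"
    "HOL-Computational_Algebra.Formal_Power_Series"
    "HOL-Number_Theory.Cong"
begin

definition partition_number :: "nat \<Rightarrow> nat" where
  "partition_number n = card {P :: nat multiset. 0 \<notin># P \<and> sum_mset P = n}"

(* The case n = 0 is separated because every natural number divides 0. *)
definition divisor_sum :: "nat \<Rightarrow> nat" where
  "divisor_sum n = (if n = 0 then 0 else \<Sum>{d. d dvd n})"

definition self_convolution :: "(nat \<Rightarrow> nat) \<Rightarrow> nat \<Rightarrow> nat \<Rightarrow> nat" where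
  "self_convolution f k n = fps_nth (Abs_fps f ^ k) n"

abbreviation p_conv :: "nat \<Rightarrow> nat \<Rightarrow> nat" where
  "p_conv \<equiv> self_convolution partition_number"

abbreviation sigma_conv :: "nat \<Rightarrow> nat \<Rightarrow> nat" where
  "sigma_conv \<equiv> self_convolution divisor_sum"

definition vanishing_pairs :: "(nat \<Rightarrow> nat \<Rightarrow> nat) \<Rightarrow> nat \<Rightarrow> (nat \<times> nat) set" where
  "vanishing_pairs c q =
     {(k, r). 0 < k \<and> k < q \<and> r < q \<and> (\<forall>n. [c k (q * n + r) = 0] (mod q))}"

end

theory Submission
  imports
    Defs
    "HOL-Computational_Algebra.Polynomial"
    "HOL-Computational_Algebra.Primes"
begin

text \<open>
  Let \<open>\<phi> = \<Prod>(1 - X\<^sup>n)\<close>. The partition series is \<open>1 / \<phi>\<close>, and \<open>X \<phi>' = - S \<phi>\<close> for the divisor sum series \<open>S\<close>.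
  Modulo a prime \<open>q\<close>, every \<open>q\<close>-th power is a series in \<open>X\<^sup>q\<close>, so multiplying by one does not affect
  which residue classes of exponents vanish. Hence \<open>\<phi>\<^sup>-\<^sup>k\<close> may be replaced by any \<open>\<phi>\<^sup>e\<close> with
  \<open>e \<equiv> -k (mod q)\<close>, and \<open>S\<^sup>k\<close> by \<open>(X J')\<^sup>k J\<^sup>q\<^sup>-\<^sup>k\<close>, where \<open>J = \<phi>\<^sup>3\<close>. The residues occurring in \<open>\<phi>\<close> and
  in \<open>J\<close> are known from the identities of Euler and Jacobi, and in most cases adding them
  suffices. The remaining cases, two for \<open>q = 11\<close> and those of \<open>S\<close> for \<open>q = 7\<close>, concern forms in the residue
  parts of \<open>J\<close>, and lie in the ideal generated by the vanishing parts of the power of \<open>J\<close> that is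
  \<open>\<phi>\<close> times a \<open>q\<close>-th power.
\<close>

subsection \<open>The Euler function as a formal power series\<close>

text \<open>Agreement of two series below order \<open>n\<close> becomes divisibility of their
  difference by \<open>fps_X ^ n\<close>, so truncated identities can be added, multiplied and
  cancelled by ring arithmetic.\<close>

lemma fps_X_power_dvd_iff:
  fixes F :: "'a::comm_ring_1 fps"
  shows "fps_X ^ n dvd F \<longleftrightarrow> (\<forall>i<n. fps_nth F i = 0)"
proof
  assume "fps_X ^ n dvd F"
  then obtain G where "F = fps_X ^ n * G" by (elim dvdE)
  then show "\<forall>i<n. fps_nth F i = 0" by (simp add: fps_X_power_mult_nth)
next
  assume *: "\<forall>i<n. fps_nth F i = 0"
  have "F = fps_X ^ n * fps_shift n F"
    by (rule fps_ext) (use * in \<open>auto simp: fps_X_power_mult_nth\<close>)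
  then show "fps_X ^ n dvd F" by (metis dvd_triv_left)
qed

definition euler_prod :: "nat \<Rightarrow> 'a::comm_ring_1 fps" where
  "euler_prod n = (\<Prod>i=1..n. 1 - fps_X ^ i)"

text \<open>A diagonal: coefficient \<open>n\<close> is read off the n-th partial product, from
  which point on it is stable.\<close>

definition euler_phi :: "'a::comm_ring_1 fps" where
  "euler_phi = Abs_fps (\<lambda>n. fps_nth (euler_prod n) n)"

lemma euler_prod_0 [simp]: "euler_prod 0 = 1"
  by (simp add: euler_prod_def)

lemma euler_prod_Suc [simp]:
  "euler_prod (Suc n) = euler_prod n * (1 - fps_X ^ Suc n)"
  by (simp add: euler_prod_def)

text \<open>Every factor beyond the m-th changes the product only by a multiple of a power of
  \<open>fps_X\<close> with exponent above \<open>m\<close>.\<close>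

lemma euler_prod_cong:
  assumes "m \<le> n"
  shows "fps_X ^ Suc m dvd (euler_prod n - euler_prod m :: 'a::comm_ring_1 fps)"
  using assms
proof (induction n rule: dec_induct)
  case (step n)
  have "euler_prod (Suc n) - euler_prod m
      = (euler_prod n - euler_prod m) - fps_X ^ Suc n * (euler_prod n :: 'a fps)"
    by (simp add: algebra_simps)
  moreover have "fps_X ^ Suc m dvd fps_X ^ Suc n * (euler_prod n :: 'a fps)"
    using step by (intro dvd_mult2 le_imp_power_dvd) simp
  ultimately show ?case using step.IH by (metis dvd_diff)
qed simp

lemma euler_phi_cong:
  "fps_X ^ Suc n dvd (euler_phi - euler_prod n :: 'a::comm_ring_1 fps)"
  unfolding fps_X_power_dvd_iff
proof safe
  fix i assume "i < Suc n"
  then have "fps_X ^ Suc i dvd (euler_prod n - euler_prod i :: 'a fps)"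
    by (intro euler_prod_cong) simp
  then show "fps_nth (euler_phi - euler_prod n :: 'a fps) i = 0"
    by (simp add: fps_X_power_dvd_iff euler_phi_def del: power_Suc)
qed

lemma euler_phi_nth_0 [simp]: "fps_nth euler_phi 0 = 1"
  by (simp add: euler_phi_def)

subsection \<open>The pentagonal number theorem\<close>

text \<open>Shanks' finite form of the theorem: modulo \<open>X\<^sup>n\<^sup>+\<^sup>1\<close> only the term \<open>s = 0\<close> survives.\<close>

definition shanks_term :: "nat \<Rightarrow> nat \<Rightarrow> int fps" where
  "shanks_term n s = (- 1) ^ s * (\<Prod>k=s+1..n. 1 - fps_X ^ k) * fps_X ^ (s * n + (s * (s + 1)) div 2)"

lemma triangular_Suc: "Suc s * (Suc s + 1) div 2 = s * (s + 1) div 2 + Suc s"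
proof -
  have "Suc s * (Suc s + 1) = s * (s + 1) + 2 * Suc s" by simp
  then show ?thesis by (metis div_mult_self2 add.commute zero_neq_numeral)
qed

text \<open>Each further difference cancels the boundary term and leaves the next one. At
  \<open>m = n\<close> the product is empty and the boundary term is one of the two new pentagonal
  terms; \<open>shanks_term (Suc n) (Suc n)\<close> is the other.\<close>

lemma shanks_telescope:
  assumes "m \<le> n"
  shows "(\<Sum>s\<le>m. shanks_term (Suc n) s - shanks_term n s)
    = - ((- 1) ^ m * (\<Prod>k=m+1..n. 1 - fps_X ^ k) * fps_X ^ (m * n + m * (m + 1) div 2 + Suc n + m))"
  using assms
proof (induction m)
  case 0
  show ?case by (simp add: shanks_term_def algebra_simps)
next
  case (Suc m)
  define Q :: "int fps" where "Q = (\<Prod>k=Suc (Suc m)..n. 1 - fps_X ^ k)"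
  have "{m+1..n} = insert (Suc m) {Suc (Suc m)..n}" using Suc.prems by auto
  then have q1: "(\<Prod>k=m+1..n. 1 - fps_X ^ k) = (1 - fps_X ^ Suc m) * Q"
    by (simp add: Q_def)
  have q2: "(\<Prod>k=Suc m+1..n. 1 - fps_X ^ k) = Q" by (simp add: Q_def)
  have q3: "(\<Prod>k=Suc m+1..Suc n. 1 - fps_X ^ k) = Q * (1 - fps_X ^ Suc n)"
    using Suc.prems by (simp add: Q_def)
  define T where "T = m * n + m * (m + 1) div 2"
  have e1: "Suc m * Suc n + Suc m * (Suc m + 1) div 2 = T + Suc n + m + Suc m"
    unfolding triangular_Suc T_def by simp
  have e2: "Suc m * n + Suc m * (Suc m + 1) div 2 = T + Suc n + m"
    unfolding triangular_Suc T_def by simp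
  have IH: "(\<Sum>s\<le>m. shanks_term (Suc n) s - shanks_term n s)
    = - ((- 1) ^ m * ((1 - fps_X ^ Suc m) * Q) * fps_X ^ (T + Suc n + m))"
    using Suc.IH Suc.prems unfolding q1 T_def by simp
  have "shanks_term (Suc n) (Suc m) - shanks_term n (Suc m)
    = - ((-1) ^ m) * Q * fps_X ^ (T + Suc n + m) * ((1 - fps_X ^ Suc n) * fps_X ^ Suc m - 1)"
    unfolding shanks_term_def e1 e2 q2 q3 power_add by (simp add: algebra_simps)
  then have "(\<Sum>s\<le>Suc m. shanks_term (Suc n) s - shanks_term n s)
    = (-1) ^ m * Q * fps_X ^ (T + Suc n + m) * fps_X ^ Suc n * fps_X ^ Suc m"
    unfolding sum.atMost_Suc IH by (simp add: algebra_simps)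
  also have "\<dots> = (-1) ^ m * Q * fps_X ^ (T + Suc n + m + Suc n + Suc m)"
    by (simp only: power_add mult.assoc)
  finally show ?case unfolding q2 e2 by (simp add: add_ac)
qed

definition pentagonal_sum :: "nat \<Rightarrow> int fps" where
  "pentagonal_sum n = 1 + (\<Sum>s=1..n. (-1) ^ s * (fps_X ^ (s * (3 * s - 1) div 2) + fps_X ^ (s *
      (3 * s + 1) div 2)))"

lemma pentagonal_sum_Suc:
  "pentagonal_sum (Suc n) = pentagonal_sum n + (-1) ^ Suc n *
    (fps_X ^ (Suc n * (3 * Suc n - 1) div 2) + fps_X ^ (Suc n * (3 * Suc n + 1) div 2))"
  unfolding pentagonal_sum_def by (subst sum.nat_ivl_Suc') (simp_all only: add_ac)

lemma shanks_identity: "(\<Sum>s\<le>n. shanks_term n s) = pentagonal_sum n"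
proof (induction n)
  case 0
  show ?case by (simp add: shanks_term_def pentagonal_sum_def)
next
  case (Suc n)
  have "(\<Sum>s\<le>Suc n. shanks_term (Suc n) s) = (\<Sum>s\<le>n. shanks_term (Suc n) s -
      shanks_term n s) + (\<Sum>s\<le>n. shanks_term n s) + shanks_term (Suc n) (Suc n)"
    by (simp add: sum_subtractf)
  also have "\<dots> = pentagonal_sum n + (-1) ^ Suc n * (fps_X ^ (n * n + n * (n + 1) div 2 + Suc n
      + n) + fps_X ^ (Suc n * Suc n + Suc n * (Suc n + 1) div 2))"
    unfolding shanks_telescope[OF order_refl] Suc.IH
    by (simp add: shanks_term_def algebra_simps)
  also have "n * n + n * (n + 1) div 2 + Suc n + n = Suc n * (3 * Suc n - 1) div 2"
  proof -
    have "Suc n * (3 * Suc n - 1) = n * (n + 1) + 2 * (n * n + Suc n + n)" by (simp add: algebra_simps)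
    then show ?thesis by (simp only: div_mult_self2 zero_neq_numeral)
  qed
  also have "Suc n * Suc n + Suc n * (Suc n + 1) div 2 = Suc n * (3 * Suc n + 1) div 2"
  proof -
    have "Suc n * (3 * Suc n + 1) = Suc n * (Suc n + 1) + 2 * (Suc n * Suc n)" by (simp add: algebra_simps)
    then show ?thesis by (simp only: div_mult_self2 zero_neq_numeral)
  qed
  finally show ?case by (simp only: pentagonal_sum_Suc)
qed

lemma pentagonal_number_theorem:
  "fps_X ^ Suc n dvd (euler_phi - pentagonal_sum n)"
proof -
  have "fps_X ^ Suc n dvd shanks_term n s" if "s \<in> {1..n}" for s
  proof -
    have "1 * n + 1 \<le> s * n + s * (s + 1) div 2"
    proof (rule add_mono)
      show "1 * n \<le> s * n" using that by (intro mult_le_mono1) simp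
      have "2 * 1 \<le> s * (s + 1)" using that by (intro order_trans[OF _ mult_le_mono[of 1 s 2]]) auto
      then show "1 \<le> s * (s + 1) div 2" by simp
    qed
    then show ?thesis unfolding shanks_term_def by (intro dvd_mult le_imp_power_dvd) simp
  qed
  then have "fps_X ^ Suc n dvd (\<Sum>s=1..n. shanks_term n s)" by (rule dvd_sum)
  moreover have "(\<Sum>s\<le>n. shanks_term n s) = euler_prod n + (\<Sum>s=1..n. shanks_term n s)"
    by (simp add: sum.atLeast1_atMost_eq sum.atMost_shift shanks_term_def euler_prod_def lessThan_Suc_atMost)
  ultimately have "fps_X ^ Suc n dvd (euler_prod n - pentagonal_sum n)"
    by (simp add: shanks_identity algebra_simps dvd_diff_commute)
  from dvd_add[OF euler_phi_cong this] show ?thesis by simp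
qed

subsection \<open>Jacobi's identity for the cube of the Euler function\<close>

text \<open>The Gaussian binomial coefficient, given by a Pascal rule so that it makes sense without
  division. Where \<open>n - k\<close> is truncated, the binomial beside it is zero.\<close>

fun qbinomial :: "'a::comm_ring_1 \<Rightarrow> nat \<Rightarrow> nat \<Rightarrow> 'a" where
  "qbinomial q n 0 = 1"
| "qbinomial q 0 (Suc k) = 0"
| "qbinomial q (Suc n) (Suc k) = qbinomial q n (Suc k) + q ^ (n - k) * qbinomial q n k"

lemma qbinomial_eq_0: "n < k \<Longrightarrow> qbinomial q n k = 0"
  by (induction q n k rule: qbinomial.induct) auto

text \<open>The quotient formula with its denominator cleared. For \<open>n < k\<close> both sides
  vanish, the right one through the factor \<open>i = n\<close>, which is
  \<open>1 - fps_X ^ 0\<close>.\<close>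

lemma qbinomial_mult_euler_prod:
  "qbinomial fps_X n k * euler_prod k = (\<Prod>i<k. 1 - (fps_X :: 'a::comm_ring_1 fps) ^ (n - i))"
proof (induction "fps_X :: 'a fps" n k rule: qbinomial.induct)
  case (2 k)
  have "(\<Prod>i<Suc k. 1 - fps_X ^ (0 - i)) = (0 :: 'a fps)"
    by (rule prod_zero) auto
  then show ?case by simp
next
  case (3 n k)
  define R :: "'a fps" where "R = (\<Prod>i<k. 1 - fps_X ^ (n - i))"
  have "(\<Prod>i<Suc k. 1 - fps_X ^ (Suc n - i)) = (1 - fps_X ^ Suc n) * R"
    unfolding R_def by (subst prod.lessThan_Suc_shift) simp
  moreover have "qbinomial fps_X (Suc n) (Suc k) * euler_prod (Suc k)
      = R * (1 - fps_X ^ (n - k)) + fps_X ^ (n - k) * (1 - fps_X ^ Suc k) * (R :: 'a fps)"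
  proof -
    have "qbinomial fps_X (Suc n) (Suc k) * euler_prod (Suc k)
      = qbinomial fps_X n (Suc k) * euler_prod (Suc k) + fps_X ^ (n - k) * (1 - fps_X ^ Suc k) *
          (qbinomial fps_X n k * euler_prod k :: 'a fps)"
      by (simp add: algebra_simps)
    then show ?thesis using 3 unfolding R_def by simp
  qed
  moreover have "R * (1 - fps_X ^ (n - k)) + fps_X ^ (n - k) * (1 - fps_X ^ Suc k) * R = (1 - fps_X
      ^ Suc n) * R"
  proof (cases "k \<le> n")
    case True
    then have "fps_X ^ Suc n = fps_X ^ (n - k) * (fps_X ^ Suc k :: 'a fps)"
      by (simp flip: power_add del: power_Suc)
    then show ?thesis by (simp only:) (simp add: algebra_simps)
  next
    case False
    then have "R = 0" unfolding R_def by (intro prod_zero) (auto intro!: bexI[of _ n])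
    then show ?thesis by simp
  qed
  ultimately show ?case by simp
qed simp

lemma dvd_prod_minus_1:
  fixes a :: "'b \<Rightarrow> 'a::comm_ring_1"
  assumes "\<And>i. i \<in> A \<Longrightarrow> x dvd a i - 1"
  shows "x dvd prod a A - 1"
  using assms
proof (induction A rule: infinite_finite_induct)
  case (insert i A)
  have *: "prod a (insert i A) - 1 = (a i - 1) * prod a A + (prod a A - 1)"
    using insert.hyps by (simp add: algebra_simps)
  show ?case unfolding * using insert by (intro dvd_add dvd_mult2) auto
qed simp_all

text \<open>To order \<open>d\<close> the binomial is the inverse of \<open>euler_prod m\<close>:
  all numerator factors are \<open>1\<close> to that order, and replacing
  \<open>euler_prod k\<close> by \<open>euler_prod m\<close> changes only higher
  coefficients.\<close>

lemma qbinomial_mult_euler_prod_cong: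
  assumes "d + k \<le> Suc n" "d \<le> Suc k" "d \<le> Suc m"
  shows "fps_X ^ d dvd (qbinomial fps_X n k * euler_prod m - 1 :: 'a::comm_ring_1 fps)"
proof -
  have "fps_X ^ d dvd (\<Prod>i<k. 1 - (fps_X :: 'a fps) ^ (n - i)) - 1"
    by (rule dvd_prod_minus_1) (use assms in \<open>auto intro: le_imp_power_dvd\<close>)
  then have "fps_X ^ d dvd (qbinomial fps_X n k * euler_prod k - 1 :: 'a fps)"
    by (simp only: qbinomial_mult_euler_prod)
  moreover have "fps_X ^ d dvd (euler_prod m - euler_prod k :: 'a fps)"
  proof (cases "k \<le> m")
    case True
    then show ?thesis using assms by (intro dvd_trans[OF le_imp_power_dvd euler_prod_cong]) auto
  next
    case False
    then have "fps_X ^ d dvd (euler_prod k - euler_prod m :: 'a fps)"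
      using assms by (intro dvd_trans[OF le_imp_power_dvd euler_prod_cong]) auto
    then show ?thesis by (metis dvd_minus_iff minus_diff_eq)
  qed
  then have "fps_X ^ d dvd qbinomial fps_X n k * (euler_prod m - euler_prod k :: 'a fps)"
    by (rule dvd_mult)
  ultimately have "fps_X ^ d dvd (qbinomial fps_X n k * euler_prod k - 1) + qbinomial fps_X n k *
      (euler_prod m - euler_prod k :: 'a fps)"
    by (rule dvd_add)
  then show ?thesis by (simp add: algebra_simps)
qed

text \<open>Rothe's identity, homogenised by \<open>w\<close> so that it can be used at \<open>z = q\<^sup>-\<^sup>n\<close> without negative powers.\<close>

lemma coeff_qbinomial_product:
  fixes q w :: "'a::comm_ring_1"
  shows "coeff (\<Prod>i<n. [:w, - (q ^ i):]) k
    = (-1) ^ k * q ^ (k * (k - 1) div 2) * qbinomial q n k * w ^ (n - k)"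
proof (induction n arbitrary: k)
  case 0
  show ?case by (cases k) auto
next
  case (Suc n)
  show ?case
  proof (cases k)
    case 0
    then show ?thesis using Suc.IH[of 0] by simp
  next
    case k: (Suc j)
    have "Suc j * (Suc j - 1) = j * (j - 1) + 2 * j" by (cases j) simp_all
    then have e: "Suc j * (Suc j - 1) div 2 = j * (j - 1) div 2 + j"
      by (simp only: div_mult_self2 zero_neq_numeral)
    have "coeff (\<Prod>i<Suc n. [:w, - (q ^ i):]) (Suc j)
      = w * coeff (\<Prod>i<n. [:w, - (q ^ i):]) (Suc j) - q ^ n * coeff (\<Prod>i<n. [:w, - (q ^ i):]) j"
      by (simp add: mult.commute)
    also have "\<dots> = (-1) ^ Suc j * q ^ (j * (j - 1) div 2 + j) * qbinomial q (Suc n) (Suc j) *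
        w ^ (n - j)"
    proof (cases "j \<le> n")
      case True
      have q: "q ^ n = q ^ j * q ^ (n - j)" using True by (simp flip: power_add)
      show ?thesis
      proof (cases "j = n")
        case True
        then show ?thesis unfolding Suc.IH e by (simp add: qbinomial_eq_0 power_add algebra_simps)
      next
        case False
        then have w: "w ^ (n - j) = w * w ^ (n - Suc j)"
          using \<open>j \<le> n\<close> by (metis Suc_diff_Suc le_neq_implies_less power_Suc)
        show ?thesis unfolding Suc.IH e q by (simp add: w power_add algebra_simps)
      qed
    qed (simp add: Suc.IH qbinomial_eq_0)
    finally show ?thesis by (simp only: k e diff_Suc_Suc)
  qed
qed

text \<open>Differentiation at 1 weights coefficient \<open>i\<close> by \<open>i\<close>; the
  factors \<open>2 * k + 1\<close> of Jacobi's identity originate here.\<close>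

lemma poly_pderiv_1:
  fixes p :: "'a::{comm_ring_1,semiring_no_zero_divisors} poly"
  assumes "degree p \<le> n"
  shows "poly (pderiv p) 1 = (\<Sum>i\<le>n. of_nat i * coeff p i)"
proof -
  have "pderiv p = (\<Sum>i\<le>n. pderiv (monom (coeff p i) i))"
    using arg_cong[OF poly_as_sum_of_monoms'[OF assms], of pderiv] by (simp add: higher_pderiv_sum[where n = 1, simplified])
  then show ?thesis by (simp add: poly_sum pderiv_monom poly_monom)
qed

lemma euler_prod_rev: "(\<Prod>i<n. 1 - fps_X ^ (n - i)) = euler_prod n"
proof -
  have "(\<Prod>i<n. 1 - fps_X ^ (n - i)) = (\<Prod>i<n. 1 - fps_X ^ Suc (n - Suc i))"
    by (rule prod.cong) (auto simp: Suc_diff_Suc simp del: power_Suc)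
  also have "\<dots> = (\<Prod>i<n. 1 - fps_X ^ Suc i)"
    by (rule prod.nat_diff_reindex)
  also have "\<dots> = euler_prod n"
    by (induction n) (simp_all del: power_Suc)
  finally show ?thesis .
qed

lemma prod_fps_X_diff_less:
  "(\<Prod>i<n. fps_X ^ n - fps_X ^ i) = (-1) ^ n * fps_X ^ (n * (n - 1) div 2) * (euler_prod n ::
      'a::comm_ring_1 fps)"
proof -
  have "(\<Prod>i<n. fps_X ^ n - fps_X ^ i) = (\<Prod>i<n. (-1) * fps_X ^ i * (1 - fps_X ^ (n - i))
      :: 'a fps)"
    by (rule prod.cong) (auto simp: algebra_simps simp flip: power_add)
  also have "\<dots> = (-1) ^ n * (\<Prod>i<n. fps_X ^ i) * euler_prod n"
    by (simp only: prod.distrib euler_prod_rev) simp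
  also have "(\<Prod>i<n. fps_X ^ i) = (fps_X ^ (\<Sum>i<n. i) :: 'a fps)"
    by (rule power_sum [symmetric])
  also have "(\<Sum>i<n. i) = n * (n - 1) div 2"
    using Sum_Ico_nat[of 0 n] by (simp add: atLeast0LessThan)
  finally show ?thesis .
qed

lemma prod_fps_X_diff_greater:
  "(\<Prod>i=Suc n..2*n. fps_X ^ n - fps_X ^ i) = fps_X ^ (n * n) * (euler_prod n :: 'a::comm_ring_1 fps)"
proof -
  have "(\<Prod>i=Suc n..2*n. fps_X ^ n - fps_X ^ i) = (\<Prod>i=1..n. fps_X ^ n * (1 - fps_X ^ i) :: 'a fps)"
    by (rule prod.reindex_bij_witness[of _ "\<lambda>i. i + n" "\<lambda>i. i - n"])
       (auto simp: algebra_simps simp flip: power_add)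
  then show ?thesis by (simp add: prod.distrib euler_prod_def power_mult)
qed

text \<open>The indices \<open>n - k\<close> and \<open>n + 1 + k\<close> will share an exponent and
  have opposite signs, so that their weights combine to \<open>2 * k + 1\<close> up to sign.\<close>

lemma sum_fold_middle:
  fixes f :: "nat \<Rightarrow> 'a::comm_monoid_add"
  shows "(\<Sum>j\<le>2*n+1. f j) = (\<Sum>k\<le>n. f (n - k) + f (n + 1 + k))"
proof -
  have "{..2*n+1} = {..n} \<union> {n+1..2*n+1}" by auto
  then have "(\<Sum>j\<le>2*n+1. f j) = (\<Sum>j\<le>n. f j) + (\<Sum>j=n+1..2*n+1. f j)"
    by (simp add: sum.union_disjoint)
  also have "(\<Sum>j\<le>n. f j) = (\<Sum>k\<le>n. f (n - k))"
    by (rule sum.reindex_bij_witness[of _ "\<lambda>k. n - k" "\<lambda>k. n - k"]) auto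
  also have "(\<Sum>j=n+1..2*n+1. f j) = (\<Sum>k\<le>n. f (n + 1 + k))"
    by (rule sum.reindex_bij_witness[of _ "\<lambda>k. n + 1 + k" "\<lambda>k. k - (n + 1)"]) auto
  finally show ?thesis by (simp add: sum.distrib)
qed

definition jacobi_sum :: "nat \<Rightarrow> int fps" where
  "jacobi_sum n = (\<Sum>k\<le>n. (-1) ^ k * of_nat (2 * k + 1) * fps_X ^ (k * (k + 1) div 2))"

text \<open>Rothe's identity with \<open>q = fps_X\<close> and \<open>w = fps_X ^ n\<close>,
  differentiated at 1: the left side comes from the coefficients, the right side from the
  product.\<close>

lemma jacobi_finite:
  "(\<Sum>k\<le>2*n+1. of_nat k * ((-1) ^ k * fps_X ^ (k * (k - 1) div 2) * qbinomial fps_X (2*n+1)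
      k * (fps_X ^ n) ^ (2*n+1 - k)))
    = - ((-1) ^ n * fps_X ^ (n * (n - 1) div 2 + n * n + n) * (euler_prod n :: int fps) ^ 2)"
proof -
  define g :: "nat \<Rightarrow> int fps poly" where "g i = [:fps_X ^ n, - (fps_X ^ i):]" for i
  have deg: "degree (\<Prod>i<2*n+1. g i) \<le> 2 * n + 1"
  proof -
    have "degree (\<Prod>i<2*n+1. g i) \<le> (\<Sum>i<2*n+1. (degree \<circ> g) i)"
      by (rule degree_prod_sum_le) simp
    also have "\<dots> \<le> (\<Sum>i<2*n+1. 1)" by (rule sum_mono) (simp add: g_def)
    finally show ?thesis by simp
  qed
  have "{..<2*n+1} = insert n ({..<n} \<union> {Suc n..2*n})" by auto
  then have "(\<Prod>i<2*n+1. g i) = prod g (insert n ({..<n} \<union> {Suc n..2*n}))" by (rule arg_cong)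
  also have "\<dots> = g n * prod g ({..<n} \<union> {Suc n..2*n})" by (rule prod.insert) auto
  also have "prod g ({..<n} \<union> {Suc n..2*n}) = (\<Prod>i<n. g i) * (\<Prod>i=Suc n..2*n. g i)"
    by (rule prod.union_disjoint) auto
  finally have split: "(\<Prod>i<2*n+1. g i) = g n * ((\<Prod>i<n. g i) * (\<Prod>i=Suc n..2*n. g i))" .
  \<comment> \<open>The factor \<open>g n\<close> vanishes at 1, so by the product rule only the
    term with its derivative \<open>- (fps_X ^ n)\<close> survives.\<close>
  have 1: "poly (pderiv (g n * R)) 1 = - (fps_X ^ n) * poly R 1" for R
    unfolding pderiv_mult poly_add poly_mult by (simp add: g_def pderiv_pCons)
  have "poly (g i) 1 = fps_X ^ n - fps_X ^ i" for i by (simp add: g_def)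
  then have "poly ((\<Prod>i<n. g i) * (\<Prod>i=Suc n..2*n. g i)) 1
    = (\<Prod>i<n. fps_X ^ n - fps_X ^ i) * (\<Prod>i=Suc n..2*n. fps_X ^ n - fps_X ^ i)"
    by (simp add: poly_prod)
  also have "\<dots> = (-1) ^ n * fps_X ^ (n * (n - 1) div 2) * fps_X ^ (n * n) * euler_prod n ^ 2"
    unfolding prod_fps_X_diff_less prod_fps_X_diff_greater by (simp add: power2_eq_square)
  finally have "poly (pderiv (\<Prod>i<2*n+1. g i)) 1
    = - (fps_X ^ n) * ((-1) ^ n * fps_X ^ (n * (n - 1) div 2) * fps_X ^ (n * n) * euler_prod n ^ 2)"
    unfolding split 1 by simp
  then show ?thesis
    unfolding poly_pderiv_1[OF deg] unfolding g_def coeff_qbinomial_product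
    by (simp add: power_add algebra_simps)
qed

text \<open>Multiplying \<open>jacobi_finite\<close> by a third copy of \<open>euler_prod n\<close>
  turns every Gaussian binomial into 1 to sufficient order. The common factor
  \<open>fps_X ^ B\<close> is then cancelled.\<close>

lemma jacobi_cube_identity:
  "fps_X ^ Suc n dvd (euler_phi ^ 3 - jacobi_sum n)"
proof -
  define B where "B = n * (n - 1) div 2 + n * n + n"
  define c :: "nat \<Rightarrow> int fps" where "c k = (-1) ^ k * fps_X ^ (k * (k - 1) div 2) *
      qbinomial fps_X (2*n+1) k * (fps_X ^ n) ^ (2*n+1 - k)" for k
  define T where "T k = k * (k + 1) div 2" for k :: nat
  have T2: "2 * T k = k * (k + 1)" for k by (simp add: T_def)
  have B2: "2 * B = n * (n - 1) + 2 * (n * n + n)" by (cases n) (simp_all add: B_def)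
  \<comment> \<open>Both paired indices give the exponent \<open>B + T k\<close>. Doubling and
    substituting \<open>n = k + j\<close> avoids the truncated subtractions and halvings.\<close>
  have e1: "(n - k) * (n - k - 1) div 2 + n * (2*n+1 - (n - k)) = B + T k" if k: "k \<le> n" for k
  proof -
    obtain j where j: "n = k + j" using k le_Suc_ex by blast
    have "2 * (B + T k) = j * (j - 1) + 2 * (n * (n + k + 1))"
      unfolding distrib_left[of 2 B] T2 B2 j by (cases j; cases k) (simp_all add: algebra_simps)
    moreover have "even (j * (j - 1))" by (cases j) auto
    ultimately have "B + T k = j * (j - 1) div 2 + n * (n + k + 1)" by (elim evenE) simp
    then show ?thesis by (simp add: j algebra_simps)
  qed
  have e2: "(n + 1 + k) * (n + 1 + k - 1) div 2 + n * (2*n+1 - (n + 1 + k)) = B + T k" if k: "k \<le> n" for k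
  proof -
    obtain j where j: "n = k + j" using k le_Suc_ex by blast
    have "2 * (B + T k) = (n + k + 1) * (n + k) + 2 * (n * j)"
      unfolding distrib_left[of 2 B] T2 B2 j by (cases j; cases k) (simp_all add: algebra_simps)
    moreover have "even ((n + k + 1) * (n + k))" by auto
    ultimately have "B + T k = (n + k + 1) * (n + k) div 2 + n * j" by (elim evenE) simp
    then show ?thesis by (simp add: j algebra_simps)
  qed
  have Tk: "k \<le> T k" for k unfolding T_def by (cases k) simp_all
  have main: "fps_X ^ (B + Suc n) dvd of_nat j * c j * euler_prod n - of_nat j * (-1) ^ j * fps_X ^ (B + T k)"
    if j: "j = n - k \<or> j = n + 1 + k" and k: "k \<le> n" for j k
  proof -
    have e: "j * (j - 1) div 2 + n * (2*n+1 - j) = B + T k" using e1[OF k] e2[OF k] j by auto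
    have "of_nat j * c j * euler_prod n - of_nat j * (-1) ^ j * fps_X ^ (B + T k)
       = of_nat j * (-1) ^ j * (fps_X ^ (B + T k) * (qbinomial fps_X (2*n+1) j * euler_prod n - 1))"
      unfolding c_def e[symmetric] power_mult[symmetric] power_add by (simp add: algebra_simps)
    moreover have "fps_X ^ (B + Suc n) dvd (fps_X ^ (B + T k) * (qbinomial fps_X (2*n+1) j *
        euler_prod n - 1) :: int fps)"
    proof -
      \<comment> \<open>The binomial is controlled only to order \<open>n - k + 1\<close>; the
        missing \<open>k\<close> is supplied by \<open>T k \<ge> k\<close>.\<close>
      have "fps_X ^ Suc (n - k) dvd (qbinomial fps_X (2*n+1) j * euler_prod n - 1 :: int fps)"
        by (rule qbinomial_mult_euler_prod_cong) (use j k in auto)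
      then have "fps_X ^ (B + T k + Suc (n - k)) dvd (fps_X ^ (B + T k) * (qbinomial fps_X (2*n+1) j
          * euler_prod n - 1) :: int fps)"
        unfolding power_add by (intro mult_dvd_mono dvd_refl)
      moreover have "B + Suc n \<le> B + T k + Suc (n - k)" using Tk[of k] k by simp
      ultimately show ?thesis using le_imp_power_dvd dvd_trans by blast
    qed
    ultimately show ?thesis by simp
  qed
  define M where "M j k = of_nat j * (-1) ^ j * (fps_X ^ (B + T k) :: int fps)" for j k
  have "fps_X ^ (B + Suc n) dvd (\<Sum>k\<le>n. (of_nat (n - k) * c (n - k) * euler_prod n - M (n -
      k) k) + (of_nat (n + 1 + k) * c (n + 1 + k) * euler_prod n - M (n + 1 + k) k))"
    unfolding M_def by (intro dvd_sum dvd_add main) simp_all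
  also have "(\<Sum>k\<le>n. (of_nat (n - k) * c (n - k) * euler_prod n - M (n - k) k) + (of_nat (n
      + 1 + k) * c (n + 1 + k) * euler_prod n - M (n + 1 + k) k))
    = (\<Sum>k\<le>n. of_nat (n - k) * c (n - k) + of_nat (n + 1 + k) * c (n + 1 + k)) * euler_prod
        n - (\<Sum>k\<le>n. M (n - k) k + M (n + 1 + k) k)"
    unfolding sum_distrib_right sum_subtractf[symmetric]
    by (rule sum.cong) (simp_all only: distrib_right add_diff_add)
  also have "(\<Sum>k\<le>n. of_nat (n - k) * c (n - k) + of_nat (n + 1 + k) * c (n + 1 + k)) = -
      ((-1) ^ n * fps_X ^ B * euler_prod n ^ 2)"
    unfolding sum_fold_middle[of "\<lambda>k. of_nat k * c k", symmetric] unfolding c_def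
        jacobi_finite B_def ..
  also have "(\<Sum>k\<le>n. M (n - k) k + M (n + 1 + k) k) = - ((-1) ^ n * fps_X ^ B * jacobi_sum n)"
  proof -
    have "M (n - k) k + M (n + 1 + k) k = - ((-1) ^ n * fps_X ^ B * ((-1) ^ k * of_nat (2 * k + 1) *
        fps_X ^ T k))" if k: "k \<le> n" for k
    proof -
      have s: "(-1) ^ (n - k) = ((-1) ^ n * (-1) ^ k :: int fps)" using k by (simp add:
          power_diff_conv_inverse minus_one_power_iff)
      have o: "of_nat (n - k) = (of_nat n - of_nat k :: int fps)" using k by simp
      show ?thesis unfolding M_def s o power_add by (simp add: algebra_simps)
    qed
    then have "(\<Sum>k\<le>n. M (n - k) k + M (n + 1 + k) k) = (\<Sum>k\<le>n. - ((-1) ^ n * fps_X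
        ^ B * ((-1) ^ k * of_nat (2 * k + 1) * fps_X ^ T k)))"
      by (intro sum.cong) auto
    also have "\<dots> = - ((-1) ^ n * fps_X ^ B * jacobi_sum n)"
      unfolding jacobi_sum_def T_def sum_negf sum_distrib_left ..
    finally show ?thesis .
  qed
  also have "- ((-1) ^ n * fps_X ^ B * euler_prod n ^ 2) * euler_prod n - - ((-1) ^ n * fps_X ^ B *
      jacobi_sum n)
    = - ((-1) ^ n) * (fps_X ^ B * (euler_prod n ^ 3 - jacobi_sum n))"
    by (simp add: algebra_simps power2_eq_square power3_eq_cube)
  finally have "fps_X ^ B * fps_X ^ Suc n dvd fps_X ^ B * (euler_prod n ^ 3 - jacobi_sum n)"
    by (cases "even n") (simp_all only: power_add dvd_minus_iff mult_minus_left mult_1_left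
        minus_minus minus_one_power_iff if_True if_False)
  then have "fps_X ^ Suc n dvd euler_prod n ^ 3 - jacobi_sum n"
    by (simp only: dvd_mult_cancel_left) simp
  moreover have "fps_X ^ Suc n dvd (euler_phi ^ 3 - euler_prod n ^ 3 :: int fps)"
  proof -
    have "euler_phi ^ 3 - euler_prod n ^ 3 = (euler_phi - euler_prod n) * (euler_phi ^ 2 + euler_phi
        * euler_prod n + euler_prod n ^ 2 :: int fps)"
      by (simp add: algebra_simps power2_eq_square power3_eq_cube)
    then show ?thesis by (simp only: dvd_mult2 euler_phi_cong)
  qed
  ultimately have "fps_X ^ Suc n dvd (euler_phi ^ 3 - euler_prod n ^ 3) + (euler_prod n ^ 3 - jacobi_sum n)"
    by (intro dvd_add)
  then show ?thesis by (simp only: diff_add_cancel add_diff_eq)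
qed

subsection \<open>Partitions and divisor sums\<close>

definition bounded_partitions :: "nat \<Rightarrow> nat \<Rightarrow> nat multiset set" where
  "bounded_partitions m n = {M. set_mset M \<subseteq> {1..m} \<and> sum_mset M = n}"

lemma bounded_partitions_0: "bounded_partitions 0 n = (if n = 0 then {{#}} else {})"
  by (auto simp: bounded_partitions_def)

text \<open>Either the part \<open>Suc m\<close> is absent, or one copy of it can be removed while
  further copies stay allowed.\<close>

lemma bounded_partitions_Suc:
  "bounded_partitions (Suc m) n = bounded_partitions m n \<union>
    (if Suc m \<le> n then add_mset (Suc m) ` bounded_partitions (Suc m) (n - Suc m) else {})"
proof (intro equalityI subsetI)
  fix M assume M: "M \<in> bounded_partitions (Suc m) n"
  show "M \<in> bounded_partitions m n \<union>
    (if Suc m \<le> n then add_mset (Suc m) ` bounded_partitions (Suc m) (n - Suc m) else {})"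
  proof (cases "Suc m \<in># M")
    case True
    then obtain N where "M = add_mset (Suc m) N" by (metis insert_DiffM)
    then show ?thesis using M by (auto simp: bounded_partitions_def)
  next
    case False
    then show ?thesis using M by (auto simp: bounded_partitions_def atLeastAtMostSuc_conv)
  qed
qed (auto simp: bounded_partitions_def split: if_splits; force)

lemma finite_bounded_partitions [simp]: "finite (bounded_partitions m n)"
proof (induction m arbitrary: n)
  case (Suc m)
  show ?case
    by (induction n rule: less_induct) (use Suc in \<open>subst bounded_partitions_Suc, auto\<close>)
qed (simp add: bounded_partitions_0)

lemma card_bounded_partitions_Suc:
  "card (bounded_partitions (Suc m) n) = card (bounded_partitions m n) +
    (if Suc m \<le> n then card (bounded_partitions (Suc m) (n - Suc m)) else 0)"
proof -
  have "bounded_partitions m n \<inter> add_mset (Suc m) ` A = {}" for A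
    by (auto simp: bounded_partitions_def)
  moreover have "inj_on (add_mset (Suc m)) A" for A by (simp add: inj_on_def)
  ultimately show ?thesis
    by (subst bounded_partitions_Suc) (simp add: card_Un_disjoint card_image)
qed

text \<open>By the recursion on the largest part, multiplication by \<open>1 - fps_X ^ Suc m\<close>
  turns the series for \<open>Suc m\<close> into the one for \<open>m\<close>.\<close>

lemma bounded_partitions_euler_prod:
  "Abs_fps (\<lambda>n. of_nat (card (bounded_partitions m n))) * euler_prod m = (1 :: int fps)"
proof (induction m)
  case 0
  show ?case by (simp add: bounded_partitions_0 fps_eq_iff)
next
  case (Suc m)
  let ?F = "\<lambda>m. Abs_fps (\<lambda>n. of_nat (card (bounded_partitions m n))) :: int fps"
  have "?F (Suc m) * (1 - fps_X ^ Suc m) = ?F m"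
  proof (rule fps_ext)
    fix n
    have "?F (Suc m) * (1 - fps_X ^ Suc m) = ?F (Suc m) - fps_X ^ Suc m * ?F (Suc m)"
      by (simp add: algebra_simps)
    then show "fps_nth (?F (Suc m) * (1 - fps_X ^ Suc m)) n = fps_nth (?F m) n"
      by (simp add: fps_X_power_mult_nth card_bounded_partitions_Suc[of m n] del: power_Suc)
  qed
  then have "?F (Suc m) * euler_prod (Suc m) = ?F m * euler_prod m"
    by (simp only: euler_prod_Suc mult.commute[of "euler_prod m"] mult.assoc[symmetric])
  then show ?case using Suc.IH by simp
qed

lemma partition_number_eq_card_bounded:
  assumes "n \<le> m"
  shows "partition_number n = card (bounded_partitions m n)"
proof -
  have "x \<le> sum_mset M" if "x \<in># M" for x :: nat and M
    using that by (auto dest!: multi_member_split)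
  then have "{P :: nat multiset. 0 \<notin># P \<and> sum_mset P = n} = bounded_partitions m n"
    using assms by (fastforce simp: bounded_partitions_def Suc_le_eq intro: gr0I)
  then show ?thesis by (simp add: partition_number_def)
qed

lemma mult_euler_phi_nth:
  fixes F :: "'a::comm_ring_1 fps"
  shows "fps_nth (F * euler_phi) n = (\<Sum>i=0..n. fps_nth F i * fps_nth (euler_prod n) (n - i))"
proof -
  have "fps_nth euler_phi j = fps_nth (euler_prod n :: 'a fps) j" if "j \<le> n" for j
    using euler_phi_cong[of n, where 'a = 'a] that unfolding fps_X_power_dvd_iff by simp
  then show ?thesis by (simp add: fps_mult_nth)
qed

lemma partition_series_mult_euler_phi:
  "Abs_fps (\<lambda>n. int (partition_number n)) * euler_phi = 1"
proof (rule fps_ext)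
  fix n
  have "fps_nth (Abs_fps (\<lambda>n. int (partition_number n)) * euler_phi) n
    = fps_nth (Abs_fps (\<lambda>i. of_nat (card (bounded_partitions n i))) * euler_prod n) n"
    unfolding mult_euler_phi_nth unfolding fps_mult_nth
    by (intro sum.cong) (auto simp: partition_number_eq_card_bounded[of _ n])
  then show "fps_nth (Abs_fps (\<lambda>n. int (partition_number n)) * euler_phi) n = fps_nth 1 n"
    by (simp only: bounded_partitions_euler_prod)
qed

section \<open>Logarithmic derivative of the Euler product\<close>

lemma fps_XD_mult: "fps_XD (F * G) = fps_XD F * G + F * fps_XD (G :: 'a::comm_ring_1 fps)"
  by (simp add: fps_XD_def algebra_simps)

lemma fps_XD_power_Suc: "fps_XD (F ^ Suc n) = of_nat (Suc n) * F ^ n * fps_XD (F :: 'a::comm_ring_1 fps)"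
  by (induction n) (simp_all add: fps_XD_mult algebra_simps)

text \<open>Logarithmic differentiation: the factor with exponent \<open>d\<close> contributes
  \<open>- d\<close> at every positive multiple of \<open>d\<close>. The condition
  \<open>0 < n\<close> is there because every \<open>d\<close> divides 0.\<close>

lemma fps_XD_euler_prod:
  "fps_XD (euler_prod m) = - (Abs_fps (\<lambda>n. \<Sum>d | d \<in> {1..m} \<and> 0 < n \<and> d
      dvd n. int d) * euler_prod m)"
proof (induction m)
  case (Suc m)
  let ?S = "\<lambda>m. Abs_fps (\<lambda>n. \<Sum>d | d \<in> {1..m} \<and> 0 < n \<and> d dvd n. int d)"
  \<comment> \<open>This is the geometric series of
    \<open>fps_X ^ Suc m / (1 - fps_X ^ Suc m)\<close>.\<close>
  define G :: "int fps" where "G = Abs_fps (\<lambda>n. if 0 < n \<and> Suc m dvd n then 1 else 0)"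
  have "G * (1 - fps_X ^ Suc m) = fps_X ^ Suc m"
  proof (rule fps_ext)
    fix n
    have "G * (1 - fps_X ^ Suc m) = G - fps_X ^ Suc m * G" by (simp add: algebra_simps)
    moreover have "Suc m dvd n \<longleftrightarrow> Suc m dvd n - Suc m" if "Suc m \<le> n"
      using that by (simp add: dvd_minus_self)
    moreover have "0 < n - Suc m \<longleftrightarrow> n \<noteq> Suc m" if "Suc m \<le> n" using that by auto
    ultimately show "fps_nth (G * (1 - fps_X ^ Suc m)) n = fps_nth (fps_X ^ Suc m) n"
      by (auto simp: G_def fps_X_power_mult_nth not_le dest: dvd_imp_le simp del: power_Suc)
  qed
  moreover have "fps_XD (1 - fps_X ^ Suc m) = - of_nat (Suc m) * (fps_X ^ Suc m :: int fps)"
    by (rule fps_ext) (simp add: fps_XD_nth fps_of_nat[symmetric] del: power_Suc of_nat_Suc)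
  moreover have "?S (Suc m) = ?S m + of_nat (Suc m) * G"
  proof (rule fps_ext)
    fix n
    have "{d \<in> {1..Suc m}. 0 < n \<and> d dvd n} = {d \<in> {1..m}. 0 < n \<and> d dvd n}
        \<union> (if 0 < n \<and> Suc m dvd n then {Suc m} else {})"
      by (auto simp: le_Suc_eq)
    then show "fps_nth (?S (Suc m)) n = fps_nth (?S m + of_nat (Suc m) * G) n"
      by (simp add: G_def fps_of_nat[symmetric] sum.union_disjoint del: of_nat_Suc)
  qed
  ultimately have *: "fps_XD (1 - fps_X ^ Suc m) = - (of_nat (Suc m) * G * (1 - fps_X ^ Suc m))"
    and S: "?S (Suc m) = ?S m + of_nat (Suc m) * G"
    by (simp_all only: mult.assoc mult_minus_left)
  show ?case
    unfolding euler_prod_Suc fps_XD_mult Suc.IH * S by (simp add: algebra_simps del: power_Suc of_nat_Suc)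
qed (simp add: fps_eq_iff)

lemma fps_XD_euler_phi:
  "fps_XD euler_phi = - (Abs_fps (\<lambda>n. int (divisor_sum n)) * euler_phi)"
proof (rule fps_ext)
  fix n
  let ?S = "Abs_fps (\<lambda>i. \<Sum>d | d \<in> {1..n} \<and> 0 < i \<and> d dvd i. int d)"
  have "int (divisor_sum i) = fps_nth ?S i" if "i \<le> n" for i
  proof -
    have "{d \<in> {1..n}. 0 < i \<and> d dvd i} = (if i = 0 then {} else {d. d dvd i})"
      using that by (auto dest: dvd_imp_le intro: dvd_pos_nat simp: Suc_le_eq)
    then show ?thesis by (simp add: divisor_sum_def)
  qed
  then have "fps_nth (Abs_fps (\<lambda>n. int (divisor_sum n)) * euler_phi) n = fps_nth (?S *
      euler_prod n) n"
    unfolding mult_euler_phi_nth unfolding fps_mult_nth by (intro sum.cong) auto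
  moreover have "fps_nth (fps_XD euler_phi) n = fps_nth (fps_XD (euler_prod n :: int fps)) n"
    by (simp add: euler_phi_def)
  ultimately show "fps_nth (fps_XD euler_phi) n = fps_nth (- (Abs_fps (\<lambda>n. int (divisor_sum
      n)) * euler_phi)) n"
    by (simp add: fps_XD_euler_prod)
qed

lemma self_convolution_of_nat:
  "fps_nth (Abs_fps (\<lambda>n. int (f n)) ^ k) n = int (self_convolution f k n)"
proof -
  have "fps_nth (Abs_fps (\<lambda>n. int (f n)) ^ k) n = int (fps_nth (Abs_fps f ^ k) n)"
    by (induction k arbitrary: n) (simp_all add: fps_mult_nth)
  then show ?thesis by (simp add: self_convolution_def)
qed

subsection \<open>Power series supported on residue classes\<close>

text \<open>The choice \<open>A = - {r}\<close> expresses that the coefficients in the class of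
  \<open>r\<close> all vanish modulo \<open>q\<close>.\<close>

definition supp_mod :: "nat \<Rightarrow> nat set \<Rightarrow> int fps \<Rightarrow> bool" where
  "supp_mod q A F \<longleftrightarrow> (\<forall>n. n mod q \<notin> A \<longrightarrow> int q dvd
      fps_nth F n)"

lemma of_nat_dvd_fps_iff: "of_nat q dvd F \<longleftrightarrow> (\<forall>n. int q dvd fps_nth F n)"
proof
  assume "\<forall>n. int q dvd fps_nth F n"
  then have "F = of_nat q * Abs_fps (\<lambda>n. fps_nth F n div int q)"
    by (simp add: fps_eq_iff fps_of_nat[symmetric])
  then show "of_nat q dvd F" by (metis dvd_triv_left)
qed (auto simp: fps_of_nat[symmetric])

lemma supp_mod_mono: "supp_mod q A F \<Longrightarrow> A \<inter> {..<q} \<subseteq> B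
    \<Longrightarrow> 0 < q \<Longrightarrow> supp_mod q B F"
  unfolding supp_mod_def using mod_less_divisor by blast

lemma supp_mod_cong:
  assumes "of_nat q dvd F - G"
  shows "supp_mod q A F \<longleftrightarrow> supp_mod q A G"
proof -
  have "int q dvd fps_nth F n - fps_nth G n" for n
    using assms by (simp add: of_nat_dvd_fps_iff)
  then have "int q dvd fps_nth F n \<longleftrightarrow> int q dvd fps_nth G n" for n
    by (metis dvd_diff_right_iff dvd_diff_left_iff)
  then show ?thesis by (simp add: supp_mod_def)
qed

lemma supp_mod_mult:
  assumes F: "supp_mod q A F" and G: "supp_mod q B G" and "0 < q"
    and C: "\<And>a b. a \<in> A \<Longrightarrow> b \<in> B \<Longrightarrow> a < q
        \<Longrightarrow> b < q \<Longrightarrow> (a + b) mod q \<in> C"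
  shows "supp_mod q C (F * G)"
  unfolding supp_mod_def fps_mult_nth
proof (intro allI impI dvd_sum)
  fix n i assume n: "n mod q \<notin> C" and i: "i \<in> {0..n}"
  have "(i mod q + (n - i) mod q) mod q = n mod q" using i by (simp add: mod_add_eq)
  with n have "i mod q \<notin> A \<or> (n - i) mod q \<notin> B"
    using C[of "i mod q" "(n - i) mod q"] \<open>0 < q\<close> by auto
  then show "int q dvd fps_nth F i * fps_nth G (n - i)"
    using F G unfolding supp_mod_def by (auto intro: dvd_mult dvd_mult2)
qed

text \<open>Since \<open>X (F\<^sup>q)' = q F\<^sup>q\<^sup>-\<^sup>1 X F'\<close>, the \<open>n\<close>-th coefficient of \<open>F\<^sup>q\<close> times \<open>n\<close> is divisible by \<open>q\<close>.\<close>

lemma supp_mod_power_prime: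
  assumes "prime q"
  shows "supp_mod q {0} (F ^ q)"
  unfolding supp_mod_def
proof (intro allI impI)
  fix n assume n: "n mod q \<notin> {0}"
  obtain q' where q': "q = Suc q'" using assms by (metis not0_implies_Suc not_prime_0)
  have "of_nat q dvd fps_XD (F ^ q)" unfolding q' fps_XD_power_Suc by (simp only: mult.assoc dvd_triv_left)
  then have "int q dvd int n * fps_nth (F ^ q) n" by (simp add: of_nat_dvd_fps_iff)
  moreover have "\<not> int q dvd int n" using n by (simp add: mod_eq_0_iff_dvd)
  ultimately show "int q dvd fps_nth (F ^ q) n"
    using assms by (simp add: prime_dvd_mult_iff)
qed

text \<open>Modulo \<open>q\<close>, multiplication by \<open>U\<close> mixes only coefficients in
  the same residue class. Constant term 1 lets the coefficients of \<open>F\<close> be recovered by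
  strong induction.\<close>

lemma supp_mod_mult_unit_iff:
  assumes U: "supp_mod q {0} U" and U0: "fps_nth U 0 = 1" and q: "0 < q"
  shows "supp_mod q A (F * U) \<longleftrightarrow> supp_mod q A F"
proof
  assume FU: "supp_mod q A (F * U)"
  have "n mod q \<notin> A \<longrightarrow> int q dvd fps_nth F n" for n
  proof (induction n rule: less_induct)
    case (less n)
    show ?case
    proof
      assume n: "n mod q \<notin> A"
      have "fps_nth (F * U) n = (\<Sum>i<n. fps_nth F i * fps_nth U (n - i)) + fps_nth F n"
        by (simp add: fps_mult_nth atLeast0AtMost lessThan_Suc_atMost[symmetric] U0)
      moreover have "int q dvd fps_nth (F * U) n" using FU n by (simp add: supp_mod_def)
      moreover have "int q dvd (\<Sum>i<n. fps_nth F i * fps_nth U (n - i))"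
      proof (rule dvd_sum)
        fix i assume i: "i \<in> {..<n}"
        show "int q dvd fps_nth F i * fps_nth U (n - i)"
        proof (cases "(n - i) mod q = 0")
          case True
          then have "i mod q = n mod q" using i by (metis lessThan_iff less_imp_le
              mod_eq_iff_dvd_symdiff_nat mod_eq_0_iff_dvd mod_eq_dvd_iff_nat)
          then show ?thesis using less.IH[of i] i n by simp
        next
          case False
          then show ?thesis using U by (simp add: supp_mod_def)
        qed
      qed
      ultimately show "int q dvd fps_nth F n" by (metis dvd_add_right_iff)
    qed
  qed
  then show "supp_mod q A F" by (simp add: supp_mod_def)
next
  assume "supp_mod q A F"
  then show "supp_mod q A (F * U)" by (rule supp_mod_mult[OF _ U q]) simp
qed

section \<open>Exponent residues of the Euler function and of its cube\<close>

lemma euler_phi_nth: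
  "fps_nth euler_phi n = fps_nth (pentagonal_sum n) n"
  using pentagonal_number_theorem[of n] unfolding fps_X_power_dvd_iff by simp

text \<open>Because of the halving, the period is \<open>2 * q\<close> rather than \<open>q\<close>;
  the supports below thus reduce to a check over \<open>2 * q\<close> values.\<close>

lemma quadratic_div_2_mod:
  fixes u v w t q :: nat
  shows "(u * t\<^sup>2 + v * t + w) div 2 mod q
    = (u * (t mod (2 * q))\<^sup>2 + v * (t mod (2 * q)) + w) div 2 mod q"
proof -
  define a b where "a = t div (2 * q)" and "b = t mod (2 * q)"
  have t: "t = b + 2 * q * a" by (simp add: a_def b_def)
  have "u * t\<^sup>2 + v * t + w = (u * b\<^sup>2 + v * b + w) + 2 * (q * (2 * u * a * b + 2 * u *
      q * a * a + v * a))"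
    unfolding t by (simp add: power2_eq_square algebra_simps)
  then have "(u * t\<^sup>2 + v * t + w) div 2 = (u * b\<^sup>2 + v * b + w) div 2 + q * (2 * u * a
      * b + 2 * u * q * a * a + v * a)"
    by (simp only: div_mult_self2 zero_neq_numeral)
  then show ?thesis by (simp add: b_def)
qed

text \<open>The second quadratic is \<open>s * (3 * s - 1)\<close> at \<open>s = b + 1\<close>,
  which removes the subtraction. The first one at 0 accounts for the constant term.\<close>

lemma supp_mod_euler_phi:
  assumes A: "\<forall>b\<in>{..<2*q}. (3 * b\<^sup>2 + 1 * b + 0) div 2 mod q \<in> A \<and> (3 *
      b\<^sup>2 + 5 * b + 2) div 2 mod q \<in> A"
    and q: "0 < q"
  shows "supp_mod q A euler_phi"
  unfolding supp_mod_def
proof (intro allI impI)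
  fix n assume n: "n mod q \<notin> A"
  have red: "n \<noteq> (3 * s\<^sup>2 + 1 * s + 0) div 2 \<and> n \<noteq> (3 * s\<^sup>2 + 5 * s +
      2) div 2" for s
  proof -
    have "s mod (2 * q) \<in> {..<2*q}" using q by simp
    then have "(3 * s\<^sup>2 + 1 * s + 0) div 2 mod q \<in> A \<and> (3 * s\<^sup>2 + 5 * s + 2)
        div 2 mod q \<in> A"
      using A unfolding quadratic_div_2_mod[of 3 s] by blast
    then show ?thesis using n by auto
  qed
  have ne: "n \<noteq> s * (3 * s - 1) div 2 \<and> n \<noteq> s * (3 * s + 1) div 2" if s: "1 \<le> s" for s
  proof -
    obtain t where t: "s = Suc t" using s by (cases s) auto
    have e: "s * (3 * s - 1) = 3 * t\<^sup>2 + 5 * t + 2" "s * (3 * s + 1) = 3 * s\<^sup>2 + 1 * s + 0"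
      unfolding t by (simp_all add: power2_eq_square algebra_simps)
    show ?thesis unfolding e using red by blast
  qed
  have zero: "fps_nth ((-1) ^ s * (fps_X ^ a + fps_X ^ b) :: int fps) n = 0" if "n \<noteq> a \<and>
      n \<noteq> b" for s a b
    using that by (simp add: minus_one_power_iff)
  have "n \<noteq> 0" using red[of 0] by auto
  moreover have "fps_nth (\<Sum>s=1..n. (-1) ^ s * (fps_X ^ (s * (3 * s - 1) div 2) + fps_X ^ (s *
      (3 * s + 1) div 2)) :: int fps) n = 0"
    unfolding fps_sum_nth by (intro sum.neutral ballI zero ne) simp
  ultimately have "fps_nth (pentagonal_sum n) n = 0"
    by (simp add: pentagonal_sum_def)
  then show "int q dvd fps_nth euler_phi n" by (simp add: euler_phi_nth)
qed

text \<open>A triangular exponent may be dropped when its Jacobi coefficient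
  \<open>2 * k + 1\<close> is divisible by \<open>q\<close>, whence the disjunction.\<close>

lemma supp_mod_euler_phi_cube:
  assumes A: "\<forall>b\<in>{..<2*q}. (1 * b\<^sup>2 + 1 * b + 0) div 2 mod q \<in> A \<or> (2 * b
      + 1) mod q = 0"
    and q: "0 < q"
  shows "supp_mod q A (euler_phi ^ 3)"
  unfolding supp_mod_def
proof (intro allI impI)
  fix n assume n: "n mod q \<notin> A"
  have "int q dvd (-1) ^ k * int (2 * k + 1) * (if n = k * (k + 1) div 2 then 1 else 0)" for k
  proof (cases "n = k * (k + 1) div 2")
    case True
    also have "k * (k + 1) = 1 * k\<^sup>2 + 1 * k + 0" by (simp add: power2_eq_square)
    finally have "(1 * (k mod (2 * q))\<^sup>2 + 1 * (k mod (2 * q)) + 0) div 2 mod q \<notin> A"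
      using n by (simp only: quadratic_div_2_mod[of 1 k, symmetric]) blast
    moreover have "k mod (2 * q) \<in> {..<2*q}" using q by simp
    ultimately have "(2 * (k mod (2 * q)) + 1) mod q = 0" using A by blast
    moreover have "[2 * (k mod (2 * q)) + 1 = 2 * k + 1] (mod q)"
      by (intro cong_add cong_mult cong_refl) (simp add: cong_def mod_mod_cancel)
    ultimately have "q dvd 2 * k + 1" by (simp add: cong_def mod_eq_0_iff_dvd)
    then have "int q dvd int (2 * k + 1)" by (simp only: of_nat_dvd_iff)
    then show ?thesis using dvd_mult dvd_mult2 by blast
  qed simp
  then have "int q dvd (\<Sum>k\<le>n. (-1) ^ k * int (2 * k + 1) * (if n = k * (k + 1) div 2 then 1 else 0))"
    by (intro dvd_sum)
  moreover have "fps_nth ((-1) ^ k * of_nat (2 * k + 1) * fps_X ^ m) n = (-1) ^ k * int (2 * k + 1)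
      * (if n = m then 1 else 0)" for k m
  proof -
    have "(-1) ^ k * of_nat (2 * k + 1) = (fps_const ((-1) ^ k * int (2 * k + 1)) :: int fps)"
      by (simp only: fps_of_nat[symmetric] fps_const_mult[symmetric] minus_one_power_iff) simp
    then show ?thesis by (simp only:) simp
  qed
  ultimately have "int q dvd fps_nth (jacobi_sum n) n"
    by (simp only: jacobi_sum_def fps_sum_nth)
  moreover have "fps_nth (euler_phi ^ 3) n = fps_nth (jacobi_sum n) n"
    using jacobi_cube_identity[of n] unfolding fps_X_power_dvd_iff by simp
  ultimately show "int q dvd fps_nth (euler_phi ^ 3) n" by simp
qed

subsection \<open>Decomposition by residue classes of the exponents\<close>

definition residue_part :: "nat \<Rightarrow> nat \<Rightarrow> 'a::comm_ring_1 fps \<Rightarrow> 'a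
    fps" where
  "residue_part q r F = Abs_fps (\<lambda>n. if n mod q = r then fps_nth F n else 0)"

lemma residue_part_simps:
  "residue_part q r (F + G) = residue_part q r F + residue_part q r G"
  "residue_part q r (numeral k * F) = numeral k * residue_part q r F"
  "residue_part q r (residue_part q s F) = (if r = s then residue_part q r F else 0)"
  by (auto simp: residue_part_def fps_eq_iff fps_of_nat[symmetric] fps_numeral_fps_const)

text \<open>Cyclic convolution over the residues; the added \<open>q\<close> keeps
  \<open>r + q - i\<close> from being truncated.\<close>

lemma residue_part_mult:
  assumes r: "r < q"
  shows "residue_part q r (F * G)
    = (\<Sum>i<q. residue_part q i F * residue_part q ((r + q - i) mod q) G)"
proof (rule fps_ext)
  fix n
  have 0: "0 < q" using r by simp
  have iff: "(n - j) mod q = (r + q - j mod q) mod q \<longleftrightarrow> n mod q = r" if "j \<le> n" for j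
  proof -
    have "(n - j) mod q = (r + q - j mod q) mod q \<longleftrightarrow> [n - j + j = r + q - j mod q
        + j] (mod q)"
      by (simp only: cong_add_rcancel_nat) (simp only: cong_def)
    also have "[r + q - j mod q + j = r + q - j mod q + j mod q] (mod q)"
      by (simp add: cong_def mod_simps)
    then have "[n - j + j = r + q - j mod q + j] (mod q) \<longleftrightarrow> [n - j + j = r + q -
        j mod q + j mod q] (mod q)"
      by (meson cong_trans cong_sym)
    also have "r + q - j mod q + j mod q = r + q"
      using mod_less_divisor[OF 0, of j] by simp
    also have "[n - j + j = r + q] (mod q) \<longleftrightarrow> n mod q = r" using that r by (simp
        add: cong_def)
    finally show ?thesis .
  qed
  have "fps_nth (\<Sum>i<q. residue_part q i F * residue_part q ((r + q - i) mod q) G) n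
    = (\<Sum>j=0..n. \<Sum>i<q. fps_nth (residue_part q i F) j * fps_nth (residue_part q ((r + q -
        i) mod q) G) (n - j))"
    unfolding fps_sum_nth fps_mult_nth by (rule sum.swap)
  also have "\<dots> = (\<Sum>j=0..n. \<Sum>i<q. if i = j mod q then if n mod q = r then fps_nth F j
      * fps_nth G (n - j) else 0 else 0)"
    by (intro sum.cong refl) (auto simp: residue_part_def iff)
  also have "\<dots> = (\<Sum>j=0..n. if n mod q = r then fps_nth F j * fps_nth G (n - j) else 0)"
    using 0 by (simp add: sum.delta)
  also have "\<dots> = fps_nth (residue_part q r (F * G)) n"
    by (simp add: residue_part_def fps_mult_nth)
  finally show "fps_nth (residue_part q r (F * G)) n = fps_nth (\<Sum>i<q. residue_part q i F *
      residue_part q ((r + q - i) mod q) G) n" ..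
qed

lemma supp_mod_residue_part_iff:
  "supp_mod q (- {r}) F \<longleftrightarrow> of_nat q dvd residue_part q r F"
  by (auto simp: supp_mod_def of_nat_dvd_fps_iff residue_part_def)

lemma supp_mod_decompose:
  assumes "supp_mod q A F" "finite A"
  shows "of_nat q dvd F - (\<Sum>r\<in>A. residue_part q r F)"
  unfolding of_nat_dvd_fps_iff
proof
  fix n
  have "fps_nth (\<Sum>r\<in>A. residue_part q r F) n = (if n mod q \<in> A then fps_nth F n else 0)"
    using assms(2) by (simp add: fps_sum_nth residue_part_def sum.delta eq_commute)
  then show "int q dvd fps_nth (F - (\<Sum>r\<in>A. residue_part q r F)) n"
    using assms(1) by (simp add: supp_mod_def)
qed

section \<open>From convolutions to powers of the Euler function\<close>

lemma cong_0_arith_progression_iff: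
  assumes "r < q"
  shows "(\<forall>n. [c (q * n + r) = 0] (mod q)) \<longleftrightarrow> supp_mod q (- {r}) (Abs_fps
      (\<lambda>n. int (c n)))"
proof -
  have "(\<forall>n. [c (q * n + r) = 0] (mod q)) \<longleftrightarrow> (\<forall>n. n mod q = r
      \<longrightarrow> q dvd c n)"
    using assms by (metis cong_0_iff mod_less mod_mult_self4 mult_div_mod_eq)
  then show ?thesis by (simp add: supp_mod_def)
qed

text \<open>The partition series cancels against \<open>k\<close> of the \<open>k + e\<close>
  factors of \<open>(euler_phi ^ m) ^ q\<close>. The free \<open>m\<close> allows a convenient
  \<open>e\<close>, for instance a multiple of 3.\<close>

lemma p_conv_vanishing_iff:
  assumes q: "prime q" and r: "r < q" and ke: "k + e = q * m"
  shows "(\<forall>n. [p_conv k (q * n + r) = 0] (mod q)) \<longleftrightarrow> supp_mod q (- {r})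
      (euler_phi ^ e)"
proof -
  define P where "P = Abs_fps (\<lambda>n. int (partition_number n))"
  have P: "Abs_fps (\<lambda>n. int (p_conv k n)) = P ^ k"
    by (simp add: fps_eq_iff P_def self_convolution_of_nat)
  have "P ^ k * (euler_phi ^ m) ^ q = (P * euler_phi) ^ k * euler_phi ^ e"
    by (simp add: power_mult_distrib mult.assoc mult.commute[of m] flip: power_mult power_add ke)
  then have e: "P ^ k * (euler_phi ^ m) ^ q = euler_phi ^ e"
    by (simp add: P_def partition_series_mult_euler_phi)
  have "supp_mod q (- {r}) (P ^ k * (euler_phi ^ m) ^ q) \<longleftrightarrow> supp_mod q (- {r}) (P ^ k)"
    by (intro supp_mod_mult_unit_iff supp_mod_power_prime q) (simp_all add: fps_nth_power_0 prime_gt_0_nat q)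
  then show ?thesis unfolding e cong_0_arith_progression_iff[OF r] P by simp
qed

text \<open>With \<open>J = euler_phi ^ 3\<close> one has \<open>fps_XD J = - 3 * S * J\<close>, so
  the product in the hypothesis is \<open>(- 3) ^ k * S ^ k * J ^ q\<close>. For
  \<open>q \<noteq> 3\<close> the scalar is invertible modulo \<open>q\<close>.\<close>

lemma sigma_conv_vanishing:
  assumes q: "prime q" "q \<noteq> 3" and r: "r < q" and k: "k \<le> q"
    and supp: "supp_mod q (- {r}) (fps_XD (euler_phi ^ 3) ^ k * (euler_phi ^ 3) ^ (q - k))"
  shows "\<forall>n. [sigma_conv k (q * n + r) = 0] (mod q)"
proof -
  define S where "S = Abs_fps (\<lambda>n. int (divisor_sum n))"
  have S: "Abs_fps (\<lambda>n. int (sigma_conv k n)) = S ^ k"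
    by (simp add: fps_eq_iff S_def self_convolution_of_nat)
  have 3: "fps_const (- 3) = (- 3 :: int fps)" by (simp add: numeral_fps_const)
  have "fps_XD (euler_phi ^ 3) = fps_const (- 3) * S * euler_phi ^ 3"
    using fps_XD_power_Suc[of "euler_phi :: int fps" 2]
    by (simp add: fps_XD_euler_phi S_def 3 eval_nat_numeral algebra_simps)
  then have "fps_XD (euler_phi ^ 3) ^ k * (euler_phi ^ 3) ^ (q - k) = fps_const ((- 3) ^ k) * S ^ k
      * (euler_phi ^ 3) ^ q"
    using k by (simp add: power_mult_distrib mult.assoc fps_const_power flip: power_add)
  moreover have "supp_mod q (- {r}) (fps_const ((- 3) ^ k) * S ^ k * (euler_phi ^ 3) ^ q)
      \<longleftrightarrow> supp_mod q (- {r}) (fps_const ((- 3) ^ k) * S ^ k)"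
    by (intro supp_mod_mult_unit_iff supp_mod_power_prime q) (simp_all add: fps_nth_power_0 prime_gt_0_nat q)
  ultimately have "supp_mod q (- {r}) (fps_const ((- 3) ^ k) * S ^ k)" using supp by simp
  moreover have "int q dvd (- 3) ^ k * x \<longleftrightarrow> int q dvd x" for x
  proof -
    have "coprime q 3" using q by (intro primes_coprime) simp_all
    then have "coprime (int q) (- 3)" by (metis coprime_minus_right_iff coprime_int_iff of_nat_numeral)
    then show ?thesis by (simp add: coprime_dvd_mult_right_iff)
  qed
  ultimately have "supp_mod q (- {r}) (S ^ k)" by (simp add: supp_mod_def)
  then show ?thesis unfolding cong_0_arith_progression_iff[OF r] S .
qed

subsection \<open>Witnesses against vanishing\<close>

definition represents :: "nat \<Rightarrow> int list \<Rightarrow> int fps \<Rightarrow> bool" where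
  "represents q xs F \<longleftrightarrow> (\<forall>i<length xs. [xs ! i = fps_nth F i] (mod int q))"

lemma represents_Nil: "represents q [] F"
  by (simp add: represents_def)

lemma represents_Cons:
  "represents q (x # xs) F \<longleftrightarrow> [x = fps_nth F 0] (mod int q) \<and> represents q
      xs (fps_shift 1 F)"
  by (auto simp: represents_def All_less_Suc2)

text \<open>Multiplication by Horner's scheme with reduction modulo \<open>q\<close>. A zero entry
  only shifts, which keeps sparse left factors cheap.\<close>

fun trunc_mult :: "int \<Rightarrow> int list \<Rightarrow> int list \<Rightarrow> int list" where
  "trunc_mult q [] ys = []"
| "trunc_mult q (x # xs) ys = (if x = 0 then 0 # trunc_mult q xs ys
    else map2 (\<lambda>y z. (x * y + z) mod q) ys (0 # trunc_mult q xs ys))"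

lemma represents_trunc_mult:
  assumes "represents q xs F" "represents q ys G"
  shows "represents q (trunc_mult (int q) xs ys) (F * G)"
  using assms(1)
proof (induction xs arbitrary: F)
  case (Cons x xs)
  have x: "[x = fps_nth F 0] (mod int q)" and xs: "represents q xs (fps_shift 1 F)"
    using Cons.prems by (simp_all add: represents_Cons)
  define zs where "zs = 0 # trunc_mult (int q) xs ys"
  have "F = fps_const (fps_nth F 0) + fps_X * fps_shift 1 F"
    by (auto simp: fps_eq_iff)
  then have FG: "F * G = fps_const (fps_nth F 0) * G + fps_X * (fps_shift 1 F * G)"
    by (metis distrib_right mult.assoc)
  have zs: "[zs ! i = fps_nth (fps_X * (fps_shift 1 F * G)) i] (mod int q)" if "i < length zs" for i
    using Cons.IH[OF xs] that by (cases i) (auto simp: zs_def represents_def)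
  show ?case
  proof (cases "x = 0")
    case True
    have "[0 * fps_nth G i + zs ! i = fps_nth (F * G) i] (mod int q)" if "i < length zs" for i
      unfolding FG fps_add_nth fps_mult_left_const_nth using x zs[OF that] True
      by (intro cong_add cong_mult) auto
    then show ?thesis by (simp add: represents_def True zs_def)
  next
    case False
    have "[(x * ys ! i + zs ! i) mod int q = fps_nth (F * G) i] (mod int q)" if "i < length zs" "i <
        length ys" for i
      unfolding FG fps_add_nth fps_mult_left_const_nth cong_mod_left using x zs[OF that(1)] assms(2) that(2)
      by (intro cong_add cong_mult) (auto simp: represents_def)
    then show ?thesis by (simp add: represents_def False zs_def)
  qed
qed (simp add: represents_Nil)

fun nonzero_residues :: "nat \<Rightarrow> nat \<Rightarrow> int list \<Rightarrow> nat set" where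
  "nonzero_residues q n [] = {}"
| "nonzero_residues q n (x # xs) =
    (if x mod int q = 0 then nonzero_residues q (Suc n) xs else insert (n mod q) (nonzero_residues q
        (Suc n) xs))"

lemma nonzero_residues_eq:
  "nonzero_residues q n xs = {(n + i) mod q | i. i < length xs \<and> xs ! i mod int q \<noteq> 0}"
proof (induction xs arbitrary: n)
  case (Cons x xs)
  have "(\<exists>i. r = (n + i) mod q \<and> i < Suc (length xs) \<and> (x # xs) ! i mod int q
      \<noteq> 0) \<longleftrightarrow>
    (r = n mod q \<and> x mod int q \<noteq> 0) \<or> (\<exists>i. r = (Suc n + i) mod q \<and> i <
        length xs \<and> xs ! i mod int q \<noteq> 0)" for r
  proof -
    have "(\<exists>i. P i) \<longleftrightarrow> P 0 \<or> (\<exists>i. P (Suc i))" for P by (metis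
        not0_implies_Suc)
    from this[of "\<lambda>i. r = (n + i) mod q \<and> i < Suc (length xs) \<and> (x # xs) ! i mod
        int q \<noteq> 0"]
    show ?thesis by auto
  qed
  then show ?case using Cons.IH[of "Suc n"] by auto
qed simp

lemma not_supp_mod:
  assumes "represents q xs F" "r \<in> nonzero_residues q 0 xs"
  shows "\<not> supp_mod q (- {r}) F"
proof -
  obtain i where i: "r = i mod q" "i < length xs" "xs ! i mod int q \<noteq> 0"
    using assms(2) by (auto simp: nonzero_residues_eq)
  then have "\<not> int q dvd fps_nth F i"
    using assms(1) by (auto simp: represents_def cong_def mod_eq_0_iff_dvd)
  then show ?thesis using i by (auto simp: supp_mod_def)
qed

text \<open>The bound is the smaller exponent of the first omitted pair, so few pentagonal terms
  determine many coefficients.\<close>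

lemma euler_phi_nth_pentagonal_sum:
  assumes n: "n < Suc m * (3 * Suc m - 1) div 2"
  shows "fps_nth euler_phi n = fps_nth (pentagonal_sum m) n"
proof -
  have "fps_nth (pentagonal_sum N) n = fps_nth (pentagonal_sum m) n" if "m \<le> N" for N
    using that
  proof (induction N rule: dec_induct)
    case (step N)
    have "Suc m * (3 * Suc m - 1) \<le> Suc N * (3 * Suc N - 1)"
      using step.hyps by (intro mult_le_mono) auto
    then have 1: "n < Suc N * (3 * Suc N - 1) div 2" using n div_le_mono order_less_le_trans by blast
    have "Suc N * (3 * Suc N - 1) \<le> Suc N * (3 * Suc N + 1)" by (intro mult_le_mono) auto
    then have 2: "n < Suc N * (3 * Suc N + 1) div 2" using 1 div_le_mono order_less_le_trans by blast
    show ?case unfolding pentagonal_sum_Suc fps_add_nth step.IH using 1 2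
      by (simp add: minus_one_power_iff del: mult_Suc mult_Suc_right)
  qed simp
  from this[of "max m n"] show ?thesis
    using pentagonal_number_theorem[of "max m n"] unfolding fps_X_power_dvd_iff by simp
qed

lemma represents_divisor_sum:
  "represents q (map (\<lambda>n. if n = 0 then 0 else \<Sum>d\<leftarrow>[1..<Suc n]. if d dvd n
      then int d else 0) [0..<N])
    (Abs_fps (\<lambda>n. int (divisor_sum n)))"
proof -
  have "{1..n} \<inter> {d. d dvd n} = {d. d dvd n}" if "n \<noteq> 0" for n :: nat
    using that by (auto dest: dvd_imp_le dvd_pos_nat[rotated] simp: Suc_le_eq)
  then have "int (divisor_sum n) = (if n = 0 then 0 else \<Sum>d\<leftarrow>[1..<Suc n]. if d dvd n
      then int d else 0)" for n
    unfolding sum_list_distinct_conv_sum_set[OF distinct_upt] set_upt atLeastLessThanSuc_atLeastAtMost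
    by (simp add: divisor_sum_def sum.If_cases)
  then show ?thesis by (simp add: represents_def)
qed

lemma euler_phi_list:
  "represents q [1,-1,-1,0,0,1,0,1,0,0,0,0,-1,0,0,-1,0,0,0,0,0,0,1,0,0,0,1,0,0,0] euler_phi"
    (is "represents q ?xs _")
proof -
  define f :: "nat \<Rightarrow> int" where "f n = (if n \<in> {0, 5, 7, 22, 26} then 1 else if n
      \<in> {1, 2, 12, 15} then -1 else 0)" for n
  \<comment> \<open>The bound 35 is \<open>5 * 14 div 2\<close>, the first pentagonal number beyond
    \<open>pentagonal_sum 4\<close>.\<close>
  have "fps_nth euler_phi n = f n" if "n < 35" for n
  proof -
    have "{1..4} = {1, 2, 3, 4 :: nat}" by auto
    then have "pentagonal_sum 4 = 1 - (fps_X ^ 1 + fps_X ^ 2) + (fps_X ^ 5 + fps_X ^ 7) - (fps_X ^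
        12 + fps_X ^ 15) + (fps_X ^ 22 + fps_X ^ 26)"
      by (simp add: pentagonal_sum_def)
    then have "fps_nth (pentagonal_sum 4) n = f n"
      by (simp only: fps_add_nth fps_sub_nth fps_one_nth fps_X_power_nth f_def insert_iff empty_iff) simp
    then show ?thesis using euler_phi_nth_pentagonal_sum[of n 4] that by simp
  qed
  moreover have "?xs = map f [0..<30]" unfolding f_def by code_simp
  ultimately show ?thesis unfolding represents_def by simp
qed

lemma divisor_sum_list: "represents q [0,1,3,4,7,6,12,8,15,13,18,12,28,14,24] (Abs_fps (\<lambda>n.
    int (divisor_sum n)))"
proof -
  have "[0,1,3,4,7,6,12,8,15,13,18,12,28,14,24::int] = map (\<lambda>n. if n = 0 then 0 else
      \<Sum>d\<leftarrow>[1..<Suc n]. if d dvd n then int d else 0) [0..<15]"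
    by code_simp
  then show ?thesis using represents_divisor_sum[of q 15] by simp
qed

text \<open>
  The list \<open>ys\<close> runs through the truncations of successive powers of the series truncated to \<open>xs\<close>,
  paired with the exponents \<open>k # ks\<close>; every pair outside \<open>L\<close> must have a nonzero witness in its list.
\<close>

fun covers_powers :: "nat \<Rightarrow> (nat \<times> nat) set \<Rightarrow> int list \<Rightarrow>
    int list \<Rightarrow> nat list \<Rightarrow> bool" where
  "covers_powers q L xs ys [] = True"
| "covers_powers q L xs ys (k # ks) \<longleftrightarrow>
    (\<forall>r\<in>set [0..<q]. (k, r) \<in> L \<or> r \<in> nonzero_residues q 0 ys) \<and>
    covers_powers q L xs (trunc_mult (int q) xs ys) ks"

text \<open>The invariant of the traversal is that \<open>ys\<close> represents \<open>F ^ j\<close>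
  when the remaining exponents are \<open>ks\<close>.\<close>

lemma covers_powersD:
  assumes "covers_powers q L xs ys ks" "represents q xs F" "represents q ys (F ^ j)"
    and "i < length ks" "r < q" "supp_mod q (- {r}) (F ^ (j + i))"
  shows "(ks ! i, r) \<in> L"
  using assms
proof (induction ks arbitrary: ys i j)
  case (Cons k ks)
  show ?case
  proof (cases i)
    case 0
    then show ?thesis using Cons.prems not_supp_mod[of q ys "F ^ j" r] by auto
  next
    case (Suc i')
    have "represents q (trunc_mult (int q) xs ys) (F ^ Suc j)"
      using represents_trunc_mult[OF Cons.prems(2,3)] by simp
    then show ?thesis using Cons.IH[of "trunc_mult (int q) xs ys" "Suc j" i'] Cons.prems Suc by simp
  qed
qed simp

text \<open>The exponents are listed in reverse because \<open>k\<close> corresponds to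
  \<open>euler_phi ^ (q - k)\<close>: the first power belongs to \<open>k = q - 1\<close>.\<close>

lemma p_conv_vanishing_pairs_subset:
  assumes q: "prime q" and xs: "represents q xs euler_phi"
    and "covers_powers q L xs xs (rev [1..<q])"
  shows "vanishing_pairs p_conv q \<subseteq> L"
proof
  fix x assume "x \<in> vanishing_pairs p_conv q"
  then obtain k r where x: "x = (k, r)" "0 < k" "k < q" "r < q" and "\<forall>n. [p_conv k (q * n +
      r) = 0] (mod q)"
    by (auto simp: vanishing_pairs_def)
  then have "supp_mod q (- {r}) (euler_phi ^ (q - k))"
    using p_conv_vanishing_iff[OF q, of r k "q - k" 1] by simp
  moreover have "q - k = 1 + (q - 1 - k)" using x by simp
  ultimately have "supp_mod q (- {r}) (euler_phi ^ (1 + (q - 1 - k)))" by (simp only:)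
  then have "(rev [1..<q] ! (q - 1 - k), r) \<in> L"
    by (intro covers_powersD[OF assms(3) xs, where j = 1]) (use xs x in \<open>simp_all del: power_Suc\<close>)
  moreover have "rev [1..<q] ! (q - 1 - k) = k"
  proof -
    obtain d where "q = Suc (k + d)" using x less_imp_Suc_add by blast
    moreover obtain k' where "k = Suc k'" using x gr0_implies_Suc by blast
    ultimately show ?thesis by (simp add: rev_nth del: upt_Suc)
  qed
  ultimately show "x \<in> L" using x by simp
qed

lemma sigma_conv_vanishing_pairs_subset:
  assumes xs: "represents q xs (Abs_fps (\<lambda>n. int (divisor_sum n)))"
    and "covers_powers q L xs xs [1..<q]"
  shows "vanishing_pairs sigma_conv q \<subseteq> L"
proof
  fix x assume "x \<in> vanishing_pairs sigma_conv q"
  then obtain k r where x: "x = (k, r)" "0 < k" "k < q" "r < q" and van: "\<forall>n. [sigma_conv k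
      (q * n + r) = 0] (mod q)"
    by (auto simp: vanishing_pairs_def)
  have "Abs_fps (\<lambda>n. int (sigma_conv k n)) = Abs_fps (\<lambda>n. int (divisor_sum n)) ^ (1
      + (k - 1))"
    using x by (simp add: fps_eq_iff self_convolution_of_nat del: power_Suc)
  then have "supp_mod q (- {r}) (Abs_fps (\<lambda>n. int (divisor_sum n)) ^ (1 + (k - 1)))"
    using van cong_0_arith_progression_iff[OF x(4), of "sigma_conv k"] by simp
  then have "([1..<q] ! (k - 1), r) \<in> L"
    by (intro covers_powersD[OF assms(2) xs, where j = 1]) (use xs x in \<open>simp_all del: power_Suc\<close>)
  then show "x \<in> L" using x by simp
qed

lemma p_conv_vanishing_pairs_subset_5:
  "vanishing_pairs p_conv 5 \<subseteq> {(1,4), (2,2), (2,3), (2,4), (4,3), (4,4)}"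
  by (rule p_conv_vanishing_pairs_subset[OF _ euler_phi_list]) (simp, code_simp)

lemma p_conv_vanishing_pairs_subset_7:
  "vanishing_pairs p_conv 7 \<subseteq> {(1,5), (4,2), (4,4), (4,5), (4,6), (6,3), (6,4), (6,6)}"
  by (rule p_conv_vanishing_pairs_subset[OF _ euler_phi_list]) (simp, code_simp)

lemma p_conv_vanishing_pairs_subset_11:
  "vanishing_pairs p_conv 11 \<subseteq>
    {(1,6), (3,7), (5,8), (7,9), (8,2), (8,4), (8,5), (8,7), (8,8), (8,9),
     (10,3), (10,6), (10,8), (10,9), (10,10)}"
  by (rule p_conv_vanishing_pairs_subset[OF _ euler_phi_list]) (simp, code_simp)

lemma sigma_conv_vanishing_pairs_subset_5:
  "vanishing_pairs sigma_conv 5 \<subseteq> {(2,1), (3,1), (3,2), (4,1), (4,2), (4,3)}"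
  by (rule sigma_conv_vanishing_pairs_subset[OF divisor_sum_list]) code_simp

lemma sigma_conv_vanishing_pairs_subset_7:
  "vanishing_pairs sigma_conv 7 \<subseteq> {(2,6), (4,3), (4,6), (5,3)}"
  by (rule sigma_conv_vanishing_pairs_subset[OF divisor_sum_list]) code_simp

subsection \<open>Polynomial relations between the residue parts\<close>

lemma dvd_diff_mult:
  fixes a b c d x :: "'a::comm_ring_1"
  assumes "x dvd a - b" "x dvd c - d"
  shows "x dvd a * c - b * d"
proof -
  have "a * c - b * d = a * (c - d) + (a - b) * d" by (simp add: algebra_simps)
  then show ?thesis using assms by simp
qed

lemma dvd_diff_power:
  fixes a b x :: "'a::comm_ring_1"
  assumes "x dvd a - b"
  shows "x dvd a ^ n - b ^ n"
proof (induction n)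
  case (Suc n)
  then show ?case using dvd_diff_mult[OF assms Suc] by simp
qed simp

text \<open>\<open>fps_XD\<close> multiplies coefficient \<open>n\<close> by \<open>n\<close>, which
  is congruent to \<open>r\<close> throughout the class of \<open>r\<close>.\<close>

lemma supp_mod_decompose_XD:
  assumes "supp_mod q A F" "finite A"
  shows "of_nat q dvd fps_XD F - (\<Sum>r\<in>A. of_nat r * residue_part q r F)"
  unfolding of_nat_dvd_fps_iff
proof
  fix n
  have "fps_nth (\<Sum>r\<in>A. of_nat r * residue_part q r F) n = (\<Sum>r\<in>A. if r = n mod q
      then int (n mod q) * fps_nth F n else 0)"
    unfolding fps_sum_nth by (intro sum.cong) (auto simp: residue_part_def fps_of_nat[symmetric])
  also have "\<dots> = (if n mod q \<in> A then int (n mod q) * fps_nth F n else 0)"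
    using assms(2) by (simp add: sum.delta)
  finally have "fps_nth (fps_XD F - (\<Sum>r\<in>A. of_nat r * residue_part q r F)) n =
    (if n mod q \<in> A then (int n - int (n mod q)) * fps_nth F n else int n * fps_nth F n)"
    by (simp add: algebra_simps)
  moreover have "int q dvd int n - int (n mod q)" by (simp add: of_nat_mod)
  ultimately show "int q dvd fps_nth (fps_XD F - (\<Sum>r\<in>A. of_nat r * residue_part q r F)) n"
    using assms(1) by (auto simp: supp_mod_def)
qed

lemma supp_mod_euler_phi_add_prime:
  assumes "prime q" "supp_mod q A (euler_phi ^ e)"
  shows "supp_mod q A (euler_phi ^ (e + m * q))"
  unfolding power_add power_mult
  by (subst supp_mod_mult_unit_iff)
     (use assms in \<open>auto intro: supp_mod_power_prime simp: fps_nth_power_0 prime_gt_0_nat\<close>)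

text \<open>
  Write \<open>A\<close> for \<open>\<phi>\<^sup>3\<close> modulo \<open>11\<close> and \<open>a, \<dots>, e\<close> for its residue parts. As \<open>\<phi>\<^sup>1\<^sup>2\<close> has the residues of \<open>\<phi>\<close>,
  five quartic forms in \<open>a, \<dots>, e\<close>, the parts of \<open>A\<^sup>4\<close> at \<open>3, 6, 8, 9, 10\<close>, vanish modulo \<open>11\<close>. The
  cofactors expressing the parts of \<open>A\<^sup>7\<close> and \<open>A\<^sup>1\<^sup>0\<close> by them were found by linear algebra over the
  field with \<open>11\<close> elements.
\<close>

lemma cube_residues_11:
  "supp_mod 11 (- {6}) (euler_phi ^ 21)" "supp_mod 11 (- {7}) (euler_phi ^ 30)"
proof -
  define R where "R r F = residue_part 11 r F" for r and F :: "int fps"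
  define a b c d e where "a = R 0 (euler_phi ^ 3)" and "b = R 1 (euler_phi ^ 3)" and "c = R 3 (euler_phi ^ 3)"
    and "d = R 6 (euler_phi ^ 3)" and "e = R 10 (euler_phi ^ 3)"
  define A where "A = a + b + c + d + e"
  \<comment> \<open>The remaining triangular residue 4 occurs only for \<open>k\<close> congruent to
    5, where 11 divides \<open>2 * k + 1\<close>.\<close>
  have "supp_mod 11 {0, 1, 3, 6, 10} (euler_phi ^ 3)"
    by (rule supp_mod_euler_phi_cube) (simp_all add: lessThan_nat_numeral)
  from supp_mod_decompose[OF this] have J: "11 dvd euler_phi ^ 3 - A"
    by (simp add: A_def a_def b_def c_def d_def e_def R_def add_ac)
  have supp_iff: "supp_mod 11 (- {r}) (euler_phi ^ (3 * n)) \<longleftrightarrow> 11 dvd R r (A ^ n)" for r n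
    using supp_mod_cong[of 11 "euler_phi ^ (3 * n)" "A ^ n" "- {r}"] dvd_diff_power[OF J, of n]
    by (simp add: power_mult supp_mod_residue_part_iff R_def)
  have "supp_mod 11 {0, 1, 2, 4, 5, 7} (euler_phi ^ 1)"
    unfolding power_one_right by (rule supp_mod_euler_phi) (simp_all add: lessThan_nat_numeral)
  from supp_mod_euler_phi_add_prime[OF _ this, of 1]
  have euler: "supp_mod 11 {0, 1, 2, 4, 5, 7} (euler_phi ^ (3 * 4))" by simp
  have H: "11 dvd R r (A ^ 4)" if "r \<in> {3, 6, 8, 9, 10}" for r
    unfolding supp_iff[symmetric] by (rule supp_mod_mono[OF euler]) (use that in auto)
  have mult: "R r (F * G) = (\<Sum>i<11. R i F * R ((r + 11 - i) mod 11) G)" if "r < 11" for r F G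
    unfolding R_def using that by (rule residue_part_mult)
  have A1: "R 0 A = a" "R (Suc 0) A = b" "R 2 A = 0" "R 3 A = c" "R 4 A = 0" "R 5 A = 0" "R 6 A = d"
    "R 7 A = 0" "R 8 A = 0" "R 9 A = 0" "R 10 A = e"
    by (simp_all add: A_def a_def b_def c_def d_def e_def R_def residue_part_simps)
  \<comment> \<open>An addition chain: each power needed is a product of two powers whose parts are
    already expanded.\<close>
  have sq3: "A ^ 3 = A ^ 2 * A" and sq4: "A ^ 4 = A ^ 2 * A ^ 2" and sq6: "A ^ 6 = A ^ 2 * A ^ 4"
    and sq7: "A ^ 7 = A ^ 3 * A ^ 4" and sq10: "A ^ 10 = A ^ 4 * A ^ 6"
    by (simp_all add: eval_nat_numeral mult_ac)
  have A2:
    "R 0 (A ^ 2) = a^2 + 2*b*e"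
    "R (Suc 0) (A ^ 2) = 2*a*b + d^2"
    "R 2 (A ^ 2) = b^2 + 2*c*e"
    "R 3 (A ^ 2) = 2*a*c"
    "R 4 (A ^ 2) = 2*b*c"
    "R 5 (A ^ 2) = 2*d*e"
    "R 6 (A ^ 2) = 2*a*d + c^2"
    "R 7 (A ^ 2) = 2*b*d"
    "R 8 (A ^ 2) = 0"
    "R 9 (A ^ 2) = 2*c*d + e^2"
    "R 10 (A ^ 2) = 2*a*e"
    by (unfold power2_eq_square) (rule trans, rule mult, simp, rule trans, simp add: lessThan_nat_numeral A1, (rule refl | algebra))+
  have A3:
    "R 0 (A ^ 3) = a^3 + 6*a*b*e + 3*d^2*e"
    "R (Suc 0) (A ^ 3) = 3*a^2*b + 3*a*d^2 + 3*b^2*e + 3*c^2*d + 3*c*e^2"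
    "R 2 (A ^ 3) = 3*a*b^2 + 6*a*c*e + 3*b*d^2"
    "R 3 (A ^ 3) = 3*a^2*c + b^3 + 6*b*c*e"
    "R 4 (A ^ 3) = 6*a*b*c + 3*c*d^2 + 3*d*e^2"
    "R 5 (A ^ 3) = 6*a*d*e + 3*b^2*c + 3*c^2*e"
    "R 6 (A ^ 3) = 3*a^2*d + 3*a*c^2 + 6*b*d*e"
    "R 7 (A ^ 3) = 6*a*b*d + 3*b*c^2 + d^3"
    "R 8 (A ^ 3) = 3*b^2*d + 6*c*d*e + e^3"
    "R 9 (A ^ 3) = 6*a*c*d + 3*a*e^2 + c^3"
    "R 10 (A ^ 3) = 3*a^2*e + 6*b*c*d + 3*b*e^2"
    by (unfold sq3) (rule trans, rule mult, simp, rule trans, simp add: lessThan_nat_numeral A2 A1, (rule refl | algebra))+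
  have A4:
    "R 0 (A ^ 4) = a^4 + 12*a^2*b*e + 12*a*d^2*e + 12*b^2*c*d + 6*b^2*e^2 + 12*c^2*d*e + 4*c*e^3"
    "R (Suc 0) (A ^ 4) = 4*a^3*b + 6*a^2*d^2 + 12*a*b^2*e + 12*a*c^2*d + 12*a*c*e^2 + 12*b*d^2*e + c^4"
    "R 2 (A ^ 4) = 6*a^2*b^2 + 12*a^2*c*e + 12*a*b*d^2 + 4*b^3*e + 12*b*c^2*d + 12*b*c*e^2 + d^4"
    "R 3 (A ^ 4) = 4*a^3*c + 4*a*b^3 + 24*a*b*c*e + 6*b^2*d^2 + 12*c*d^2*e + 4*d*e^3"
    "R 4 (A ^ 4) = 12*a^2*b*c + 12*a*c*d^2 + 12*a*d*e^2 + b^4 + 12*b^2*c*e + 4*c^3*d + 6*c^2*e^2"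
    "R 5 (A ^ 4) = 12*a^2*d*e + 12*a*b^2*c + 12*a*c^2*e + 12*b*c*d^2 + 12*b*d*e^2"
    "R 6 (A ^ 4) = 4*a^3*d + 6*a^2*c^2 + 24*a*b*d*e + 4*b^3*c + 12*b*c^2*e + 4*d^3*e"
    "R 7 (A ^ 4) = 12*a^2*b*d + 12*a*b*c^2 + 4*a*d^3 + 12*b^2*d*e + 6*c^2*d^2 + 12*c*d*e^2 + e^4"
    "R 8 (A ^ 4) = 12*a*b^2*d + 24*a*c*d*e + 4*a*e^3 + 6*b^2*c^2 + 4*b*d^3 + 4*c^3*e"
    "R 9 (A ^ 4) = 12*a^2*c*d + 6*a^2*e^2 + 4*a*c^3 + 4*b^3*d + 24*b*c*d*e + 4*b*e^3"
    "R 10 (A ^ 4) = 4*a^3*e + 24*a*b*c*d + 12*a*b*e^2 + 4*b*c^3 + 4*c*d^3 + 6*d^2*e^2"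
    by (unfold sq4) (rule trans, rule mult, simp, rule trans, simp add: lessThan_nat_numeral A2, (rule refl | algebra))+
  have A6:
    "R 0 (A ^ 6) = a^6 + 30*a^4*b*e + 60*a^3*d^2*e + 180*a^2*b^2*c*d + 90*a^2*b^2*e^2 +
        180*a^2*c^2*d*e + 60*a^2*c*e^3 + 60*a*b^2*c^3 + 120*a*b*c*d^3 + 180*a*b*d^2*e^2 + 30*a*c^4*e
        + 6*b^5*d + 120*b^3*c*d*e + 20*b^3*e^3 + 60*b*c^3*d^2 + 180*b*c^2*d*e^2 + 30*b*c*e^4 +
        6*c*d^5 + 15*d^4*e^2"
    "R (Suc 0) (A ^ 6) = 6*a^5*b + 15*a^4*d^2 + 60*a^3*b^2*e + 60*a^3*c^2*d + 60*a^3*c*e^2 +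
        180*a^2*b*d^2*e + 15*a^2*c^4 + 120*a*b^3*c*d + 60*a*b^3*e^2 + 360*a*b*c^2*d*e +
        120*a*b*c*e^3 + 30*a*d^4*e + 20*b^3*c^3 + 60*b^2*c*d^3 + 90*b^2*d^2*e^2 + 30*b*c^4*e +
        60*c^2*d^3*e + 60*c*d^2*e^3 + 6*d*e^5"
    "R 2 (A ^ 6) = 15*a^4*b^2 + 30*a^4*c*e + 60*a^3*b*d^2 + 60*a^2*b^3*e + 180*a^2*b*c^2*d +
        180*a^2*b*c*e^2 + 15*a^2*d^4 + 180*a*b^2*d^2*e + 30*a*b*c^4 + 60*a*c^2*d^3 + 180*a*c*d^2*e^2
        + 30*a*d*e^4 + 30*b^4*c*d + 15*b^4*e^2 + 180*b^2*c^2*d*e + 60*b^2*c*e^3 + 30*b*d^4*e +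
        15*c^4*d^2 + 60*c^3*d*e^2 + 15*c^2*e^4"
    "R 3 (A ^ 6) = 6*a^5*c + 20*a^3*b^3 + 120*a^3*b*c*e + 90*a^2*b^2*d^2 + 180*a^2*c*d^2*e +
        60*a^2*d*e^3 + 30*a*b^4*e + 180*a*b^2*c^2*d + 180*a*b^2*c*e^2 + 30*a*b*d^4 + 120*a*c^3*d*e +
        60*a*c^2*e^3 + 60*b^3*d^2*e + 15*b^2*c^4 + 60*b*c^2*d^3 + 180*b*c*d^2*e^2 + 30*b*d*e^4 +
        6*c^5*e + d^6"
    "R 4 (A ^ 6) = 30*a^4*b*c + 60*a^3*c*d^2 + 60*a^3*d*e^2 + 15*a^2*b^4 + 180*a^2*b^2*c*e +
        60*a^2*c^3*d + 90*a^2*c^2*e^2 + 60*a*b^3*d^2 + 360*a*b*c*d^2*e + 120*a*b*d*e^3 + 6*a*c^5 +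
        6*b^5*e + 60*b^3*c^2*d + 60*b^3*c*e^2 + 15*b^2*d^4 + 120*b*c^3*d*e + 60*b*c^2*e^3 +
        30*c*d^4*e + 20*d^3*e^3"
    "R 5 (A ^ 6) = 30*a^4*d*e + 60*a^3*b^2*c + 60*a^3*c^2*e + 180*a^2*b*c*d^2 + 180*a^2*b*d*e^2 +
        6*a*b^5 + 120*a*b^3*c*e + 120*a*b*c^3*d + 180*a*b*c^2*e^2 + 30*a*c*d^4 + 60*a*d^3*e^2 +
        15*b^4*d^2 + 180*b^2*c*d^2*e + 60*b^2*d*e^3 + 6*b*c^5 + 20*c^3*d^3 + 90*c^2*d^2*e^2 +
        30*c*d*e^4 + e^6"
    "R 6 (A ^ 6) = 6*a^5*d + 15*a^4*c^2 + 120*a^3*b*d*e + 60*a^2*b^3*c + 180*a^2*b*c^2*e +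
        60*a^2*d^3*e + 180*a*b^2*c*d^2 + 180*a*b^2*d*e^2 + 180*a*c^2*d^2*e + 120*a*c*d*e^3 + 6*a*e^5
        + b^6 + 30*b^4*c*e + 60*b^2*c^3*d + 90*b^2*c^2*e^2 + 30*b*c*d^4 + 60*b*d^3*e^2 + 30*c^4*d*e
        + 20*c^3*e^3"
    "R 7 (A ^ 6) = 30*a^4*b*d + 60*a^3*b*c^2 + 20*a^3*d^3 + 180*a^2*b^2*d*e + 90*a^2*c^2*d^2 +
        180*a^2*c*d*e^2 + 15*a^2*e^4 + 30*a*b^4*c + 180*a*b^2*c^2*e + 120*a*b*d^3*e + 30*a*c^4*d +
        60*a*c^3*e^2 + 60*b^3*c*d^2 + 60*b^3*d*e^2 + 180*b*c^2*d^2*e + 120*b*c*d*e^3 + 6*b*e^5 + c^6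
        + 6*d^5*e"
    "R 8 (A ^ 6) = 60*a^3*b^2*d + 120*a^3*c*d*e + 20*a^3*e^3 + 90*a^2*b^2*c^2 + 60*a^2*b*d^3 +
        60*a^2*c^3*e + 120*a*b^3*d*e + 180*a*b*c^2*d^2 + 360*a*b*c*d*e^2 + 30*a*b*e^4 + 6*a*d^5 +
        6*b^5*c + 60*b^3*c^2*e + 60*b^2*d^3*e + 30*b*c^4*d + 60*b*c^3*e^2 + 15*c^2*d^4 +
        60*c*d^3*e^2 + 15*d^2*e^4"
    "R 9 (A ^ 6) = 30*a^4*c*d + 15*a^4*e^2 + 20*a^3*c^3 + 60*a^2*b^3*d + 360*a^2*b*c*d*e +
        60*a^2*b*e^3 + 60*a*b^3*c^2 + 60*a*b^2*d^3 + 120*a*b*c^3*e + 120*a*c*d^3*e + 60*a*d^2*e^3 +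
        30*b^4*d*e + 90*b^2*c^2*d^2 + 180*b^2*c*d*e^2 + 15*b^2*e^4 + 6*b*d^5 + 60*c^3*d^2*e +
        60*c^2*d*e^3 + 6*c*e^5"
    "R 10 (A ^ 6) = 6*a^5*e + 120*a^3*b*c*d + 60*a^3*b*e^2 + 60*a^2*b*c^3 + 60*a^2*c*d^3 +
        90*a^2*d^2*e^2 + 30*a*b^4*d + 360*a*b^2*c*d*e + 60*a*b^2*e^3 + 60*a*c^3*d^2 +
        180*a*c^2*d*e^2 + 30*a*c*e^4 + 15*b^4*c^2 + 20*b^3*d^3 + 60*b^2*c^3*e + 120*b*c*d^3*e +
        60*b*d^2*e^3 + 6*c^5*d + 15*c^4*e^2"
    by (unfold sq6) (rule trans, rule mult, simp, rule trans, simp add: lessThan_nat_numeral A2 A4, (rule refl | algebra))+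
  \<comment> \<open>Give \<open>a\<close>, \<open>b\<close>, \<open>c\<close>, \<open>d\<close>,
    \<open>e\<close> the weights 0, 1, 3, 6, 10. The cofactor of \<open>R s (A^4)\<close> is then
    homogeneous of degree 3 and of weight \<open>6 - s\<close> modulo 11; in \<open>c10\<close> the
    degree is 6 and the weight \<open>7 - s\<close>. The last bracket collects the multiples of 11,
    making the identity exact over the integers.\<close>
  have c7: "R 6 (A ^ 7) = (4*a^2*c - b^3 - b*c*e) * R 3 (A^4) + (4*d^2*e - a^3 - a*b*e) * R 6 (A^4)
      + (4*a*e^2 - a*c*d - c^3) * R 8 (A^4) + (4*b^2*d - c*d*e - e^3) * R 9 (A^4) + (4*b*c^2 - a*b*d
      - d^3) * R 10 (A^4) + 11 * (a^6*d + a^5*c^2 + 22*a^4*b*d*e + 12*a^3*b^3*c + 30*a^3*b*c^2*e +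
      12*a^3*d^3*e + 54*a^2*b^2*c*d^2 + 54*a^2*b^2*d*e^2 + 54*a^2*c^2*d^2*e + 30*a^2*c*d*e^3 +
      a^2*e^5 + a*b^6 + 22*a*b^4*c*e + 30*a*b^2*c^3*d + 54*a*b^2*c^2*e^2 + 22*a*b*c*d^4 +
      30*a*b*d^3*e^2 + 22*a*c^4*d*e + 12*a*c^3*e^3 + b^5*d^2 + 30*b^3*c*d^2*e + 12*b^3*d*e^3 +
      b^2*c^5 + 12*b*c^3*d^3 + 54*b*c^2*d^2*e^2 + 22*b*c*d*e^4 + b*e^6 + c^6*e + c*d^6 + d^5*e^2)"
    by (unfold sq7) (rule trans, rule mult, simp, rule trans, simp add: lessThan_nat_numeral A3 A4, unfold A4, algebra)
  have c10: "R 7 (A ^ 10) = (4*a^4*b*c + 3*a^2*c^3*d + 3*a*b*d*e^3 + 5*a*c^5 + 4*b*c^3*d*e +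
      3*d^3*e^3 - 3*a^2*b^4 - 4*a^2*b^2*c*e - 2*a^2*c^2*e^2 - 2*a*b*c*d^2*e - 5*b^5*e - 2*b^3*c^2*d
      - 4*b^3*c*e^2 - 2*b^2*d^4 - 2*c*d^4*e) * R 3 (A^4) + (2*a^3*c^2*d + a^2*c^4 + 5*a*b^3*c*d +
      4*a*b^3*e^2 + a*b*c*e^3 + 4*a*d^4*e + 4*b^3*c^3 + b^2*c*d^3 + c^2*d^3*e - 5*a^5*b - 3*a^4*d^2
      - a^3*c*e^2 - 3*a^2*b*d^2*e - 3*a*b*c^2*d*e - 5*b^2*d^2*e^2 - 3*b*c^4*e) * R 6 (A^4) +
      (2*a^3*b*c*d + a^3*b*e^2 + 2*a^2*b*c^3 + 3*a^2*d^2*e^2 + 2*a*b^4*d + 5*a*b^2*e^3 +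
      2*a*c^2*d*e^2 + 4*a*c*e^4 + 3*b^4*c^2 + 4*b^2*c^3*e - a^5*e - 4*a*b^2*c*d*e - 4*a*c^3*d^2 -
      5*b^3*d^3 - 5*c^5*d - 3*c^4*e^2) * R 8 (A^4) + (5*a^4*c*d + 2*a^3*c^3 + a^2*b*c*d*e +
      a^2*b*e^3 + 4*b^4*d*e + 4*b^2*c^2*d^2 - a^4*e^2 - a*b^3*c^2 - 3*b^2*e^4 - 5*c*e^5) * R 9 (A^4)
      + (3*a^3*b^2*d + 4*b*c^4*d - 5*a*d^5 - 3*c^2*d^4) * R 10 (A^4) + 11 * (10*a^8*b*d +
      34*a^7*b*c^2 + 12*a^7*d^3 + 240*a^6*b^2*d*e + 110*a^6*c^2*d^2 + 230*a^6*c*d*e^2 + 20*a^6*e^4 +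
      116*a^5*b^4*c + 686*a^5*b^2*c^2*e + 468*a^5*b*d^3*e + 108*a^5*c^4*d + 230*a^5*c^3*e^2 +
      1132*a^4*b^3*c*d^2 + 1140*a^4*b^3*d*e^2 + 3418*a^4*b*c^2*d^2*e + 2286*a^4*b*c*d*e^3 +
      114*a^4*b*e^5 + 16*a^4*c^6 + 116*a^4*d^5*e + 12*a^3*b^7 + 468*a^3*b^5*c*e + 1518*a^3*b^3*c^3*d
      + 2300*a^3*b^3*c^2*e^2 + 1144*a^3*b^2*c*d^4 + 2294*a^3*b^2*d^3*e^2 + 2270*a^3*b*c^4*d*e +
      1530*a^3*b*c^3*e^3 + 1144*a^3*c^2*d^4*e + 1520*a^3*c*d^3*e^3 + 228*a^3*d^2*e^5 +
      114*a^2*b^6*d^2 + 3428*a^2*b^4*c*d^2*e + 1128*a^2*b^4*d*e^3 + 224*a^2*b^3*c^5 +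
      2288*a^2*b^2*c^3*d^3 + 10332*a^2*b^2*c^2*d^2*e^2 + 3416*a^2*b^2*c*d*e^4 + 114*a^2*b^2*e^6 +
      218*a^2*b*c^6*e + 240*a^2*b*c*d^6 + 684*a^2*b*d^5*e^2 + 1150*a^2*c^4*d^3*e +
      2288*a^2*c^3*d^2*e^3 + 684*a^2*c^2*d*e^5 + 34*a^2*c*e^7 + 10*a*b^8*e + 224*a*b^6*c^2*d +
      240*a*b^6*c*e^2 + 120*a*b^5*d^4 + 2272*a*b^4*c^3*d*e + 1146*a*b^4*c^2*e^3 + 2304*a*b^3*c*d^4*e
      + 1534*a*b^3*d^3*e^3 + 682*a*b^2*c^5*d^2 + 3428*a*b^2*c^4*d*e^2 + 1140*a*b^2*c^3*e^4 +
      468*a*b*c^3*d^5 + 3440*a*b*c^2*d^4*e^2 + 2280*a*b*c*d^3*e^4 + 228*a*b*d^2*e^6 +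
      236*a*c^6*d^2*e + 464*a*c^5*d*e^3 + 116*a*c^4*e^5 + 10*a*c*d^8 + 34*a*d^7*e^2 + 34*b^7*d^2*e +
      16*b^6*c^4 + 230*b^5*c^2*d^3 + 688*b^5*c*d^2*e^2 + 116*b^5*d*e^4 + 108*b^4*c^5*e + 22*b^4*d^6
      + 1516*b^3*c^3*d^3*e + 2300*b^3*c^2*d^2*e^3 + 468*b^3*c*d*e^5 + 12*b^3*e^7 + 34*b^2*c^7*d +
      118*b^2*c^6*e^2 + 232*b^2*c*d^6*e + 230*b^2*d^5*e^3 + 116*b*c^5*d^4 + 1140*b*c^4*d^3*e^2 +
      1144*b*c^3*d^2*e^4 + 240*b*c^2*d*e^6 + 10*b*c*e^8 + 10*c^8*d*e + 12*c^7*e^3 + 12*c^3*d^7 +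
      118*c^2*d^6*e^2 + 112*c*d^5*e^4 + 18*d^4*e^6)"
    by (unfold sq10) (rule trans, rule mult, simp, rule trans, simp add: lessThan_nat_numeral A4 A6, unfold A4, algebra)
  have "11 dvd R 6 (A ^ 7)" unfolding c7 by (intro dvd_add dvd_mult H dvd_triv_left) simp_all
  then show "supp_mod 11 (- {6}) (euler_phi ^ 21)" using supp_iff[of 6 7] by simp
  have "11 dvd R 7 (A ^ 10)" unfolding c10 by (intro dvd_add dvd_mult H dvd_triv_left) simp_all
  then show "supp_mod 11 (- {7}) (euler_phi ^ 30)" using supp_iff[of 7 10] by simp
qed

text \<open>The same method, with the relations coming from \<open>(\<phi>\<^sup>3)\<^sup>5 = \<phi> (\<phi>\<^sup>2)\<^sup>7\<close>.\<close>

lemma XD_cube_residues_7: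
  assumes "(k, r) \<in> {(2, 6), (4, 3), (4, 6), (5, 3)}"
  shows "supp_mod 7 (- {r}) (fps_XD (euler_phi ^ 3) ^ k * (euler_phi ^ 3) ^ (7 - k))"
proof -
  define R where "R r F = residue_part 7 r F" for r and F :: "int fps"
  define a b c where "a = R 0 (euler_phi ^ 3)" and "b = R 1 (euler_phi ^ 3)" and "c = R 3 (euler_phi ^ 3)"
  define A where "A = a + b + c"
  \<comment> \<open>Modulo 7, \<open>fps_XD\<close> multiplies the parts \<open>a\<close>,
    \<open>b\<close>, \<open>c\<close> by 0, 1, 3.\<close>
  define B where "B = b + 3 * c"
  have supp: "supp_mod 7 {0, 1, 3} (euler_phi ^ 3)"
    by (rule supp_mod_euler_phi_cube) (simp_all add: lessThan_nat_numeral)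
  from supp_mod_decompose[OF this] have J: "7 dvd euler_phi ^ 3 - A"
    by (simp add: A_def a_def b_def c_def R_def add_ac)
  from supp_mod_decompose_XD[OF supp] have XDJ: "7 dvd fps_XD (euler_phi ^ 3) - B"
    by (simp add: B_def b_def c_def R_def)
  have "supp_mod 7 {0, 1, 2, 5} (euler_phi ^ 1)"
    unfolding power_one_right by (rule supp_mod_euler_phi) (simp_all add: lessThan_nat_numeral)
  from supp_mod_euler_phi_add_prime[OF _ this, of 2]
  have euler: "supp_mod 7 {0, 1, 2, 5} ((euler_phi ^ 3) ^ 5)" by (simp flip: power_mult)
  have H: "7 dvd R r (A ^ 5)" if "r \<in> {3, 4, 6}" for r
  proof -
    have "supp_mod 7 (- {r}) ((euler_phi ^ 3) ^ 5)" by (rule supp_mod_mono[OF euler]) (use that in auto)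
    then show ?thesis using supp_mod_cong[of 7 "(euler_phi ^ 3) ^ 5" "A ^ 5" "- {r}"]
        dvd_diff_power[OF J, of 5]
      by (simp add: supp_mod_residue_part_iff R_def)
  qed
  have mult: "R r (F * G) = (\<Sum>i<7. R i F * R ((r + 7 - i) mod 7) G)" if "r < 7" for r F G
    unfolding R_def using that by (rule residue_part_mult)
  have A1: "R 0 A = a" "R (Suc 0) A = b" "R 2 A = 0" "R 3 A = c" "R 4 A = 0" "R 5 A = 0" "R 6 A = 0"
    and B1: "R 0 B = 0" "R (Suc 0) B = b" "R 2 B = 0" "R 3 B = 3 * c" "R 4 B = 0" "R 5 B = 0" "R 6 B = 0"
    by (simp_all add: A_def B_def a_def b_def c_def R_def residue_part_simps)
  have sq: "A ^ 3 = A ^ 2 * A" "B ^ 4 = B ^ 2 * B ^ 2" "A ^ 5 = A ^ 2 * A ^ 3" "B ^ 5 = B ^ 4 * B"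
    by (simp_all add: eval_nat_numeral mult_ac)
  have A2:
    "R 0 (A ^ 2) = a^2"
    "R (Suc 0) (A ^ 2) = 2*a*b"
    "R 2 (A ^ 2) = b^2"
    "R 3 (A ^ 2) = 2*a*c"
    "R 4 (A ^ 2) = 2*b*c"
    "R 5 (A ^ 2) = 0"
    "R 6 (A ^ 2) = c^2"
    by (unfold power2_eq_square) (rule trans, rule mult, simp, rule trans, simp add: lessThan_nat_numeral A1, (rule refl | algebra))+
  have A3:
    "R 0 (A ^ 3) = a^3 + 3*b*c^2"
    "R (Suc 0) (A ^ 3) = 3*a^2*b"
    "R 2 (A ^ 3) = 3*a*b^2 + c^3"
    "R 3 (A ^ 3) = 3*a^2*c + b^3"
    "R 4 (A ^ 3) = 6*a*b*c"
    "R 5 (A ^ 3) = 3*b^2*c"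
    "R 6 (A ^ 3) = 3*a*c^2"
    by (unfold sq(1)) (rule trans, rule mult, simp, rule trans, simp add: lessThan_nat_numeral A2 A1, (rule refl | algebra))+
  have A5:
    "R 0 (A ^ 5) = a^5 + 30*a^2*b*c^2 + 5*b^4*c"
    "R (Suc 0) (A ^ 5) = 5*a^4*b + 30*a*b^2*c^2 + c^5"
    "R 2 (A ^ 5) = 10*a^3*b^2 + 10*a^2*c^3 + 10*b^3*c^2"
    "R 3 (A ^ 5) = 5*a^4*c + 10*a^2*b^3 + 20*a*b*c^3"
    "R 4 (A ^ 5) = 20*a^3*b*c + 5*a*b^4 + 10*b^2*c^3"
    "R 5 (A ^ 5) = 30*a^2*b^2*c + 5*a*c^4 + b^5"
    "R 6 (A ^ 5) = 10*a^3*c^2 + 20*a*b^3*c + 5*b*c^4"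
    by (unfold sq(3)) (rule trans, rule mult, simp, rule trans, simp add: lessThan_nat_numeral A2 A3, (rule refl | algebra))+
  have B2:
    "R 0 (B ^ 2) = 0"
    "R (Suc 0) (B ^ 2) = 0"
    "R 2 (B ^ 2) = b^2"
    "R 3 (B ^ 2) = 0"
    "R 4 (B ^ 2) = 6*b*c"
    "R 5 (B ^ 2) = 0"
    "R 6 (B ^ 2) = 9*c^2"
    by (unfold power2_eq_square) (rule trans, rule mult, simp, rule trans, simp add: lessThan_nat_numeral B1, (rule refl | algebra))+
  have B4:
    "R 0 (B ^ 4) = 0"
    "R (Suc 0) (B ^ 4) = 54*b^2*c^2"
    "R 2 (B ^ 4) = 0"
    "R 3 (B ^ 4) = 108*b*c^3"
    "R 4 (B ^ 4) = b^4"
    "R 5 (B ^ 4) = 81*c^4"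
    "R 6 (B ^ 4) = 12*b^3*c"
    by (unfold sq(2)) (rule trans, rule mult, simp, rule trans, simp add: lessThan_nat_numeral B2, (rule refl | algebra))+
  have B5:
    "R 0 (B ^ 5) = 15*b^4*c"
    "R (Suc 0) (B ^ 5) = 243*c^5"
    "R 2 (B ^ 5) = 90*b^3*c^2"
    "R 3 (B ^ 5) = 0"
    "R 4 (B ^ 5) = 270*b^2*c^3"
    "R 5 (B ^ 5) = b^5"
    "R 6 (B ^ 5) = 405*b*c^4"
    by (unfold sq(4)) (rule trans, rule mult, simp, rule trans, simp add: lessThan_nat_numeral B4 B1, (rule refl | algebra))+
  \<comment> \<open>In \<open>c1\<close>, \<open>c2\<close> and \<open>c3\<close> the cofactors are
    quadratic forms, graded by residue weights modulo 7.\<close>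
  have c1: "R 6 (B ^ 2 * A ^ 5) = (-(a*c)) * R 3 (A ^ 5) + (b^2) * R 4 (A ^ 5) + 7 * (2*a^5*c^2 +
      10*a^3*b^3*c + 50*a^2*b*c^4 + 15*b^4*c^3)"
    by (rule trans, rule mult, simp, rule trans, simp add: lessThan_nat_numeral B2 A5, unfold A5, algebra)
  have c2: "R 3 (B ^ 4 * A ^ 3) = (-(3*c^2)) * R 4 (A ^ 5) + 7 * (24*a^3*b*c^3 + 36*a*b^4*c^2 + 93*b^2*c^5)"
    by (rule trans, rule mult, simp, rule trans, simp add: lessThan_nat_numeral B4 A3, unfold A5, algebra)
  have c3: "R 6 (B ^ 4 * A ^ 3) = (2*b^2) * R 4 (A ^ 5) + 7 * (81*a^2*b*c^4 + 41*b^4*c^3 -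
      4*a^3*b^3*c - a*b^6)"
    by (rule trans, rule mult, simp, rule trans, simp add: lessThan_nat_numeral B4 A3, unfold A5, algebra)
  \<comment> \<open>All integer coefficients of this form are themselves divisible by 7.\<close>
  have c4: "R 3 (B ^ 5 * A ^ 2) = 7 * (30*a*b^4*c^2 + 189*b^2*c^5)"
    by (rule trans, rule mult, simp, rule trans, simp add: lessThan_nat_numeral B5 A2, algebra)
  have "7 dvd R 6 (B ^ 2 * A ^ 5)" "7 dvd R 3 (B ^ 4 * A ^ 3)" "7 dvd R 6 (B ^ 4 * A ^ 3)" "7 dvd R
      3 (B ^ 5 * A ^ 2)"
    unfolding c1 c2 c3 c4 by (intro dvd_add dvd_mult H dvd_triv_left; simp)+
  then have "7 dvd R r (B ^ k * A ^ (7 - k))" using assms by auto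
  moreover have "7 dvd fps_XD (euler_phi ^ 3) ^ k * (euler_phi ^ 3) ^ (7 - k) - B ^ k * A ^ (7 - k)"
    by (intro dvd_diff_mult dvd_diff_power J XDJ)
  ultimately show ?thesis
    using supp_mod_cong[of 7 "fps_XD (euler_phi ^ 3) ^ k * (euler_phi ^ 3) ^ (7 - k)" "B ^ k * A ^
        (7 - k)" "- {r}"]
    by (simp add: supp_mod_residue_part_iff R_def)
qed

subsection \<open>The vanishing pairs\<close>

lemma p_conv_vanishing_pairsI:
  assumes "prime q" "supp_mod q A (euler_phi ^ e)" "k + e = q * m" "0 < k" "k < q" "r < q" "r \<notin> A"
  shows "(k, r) \<in> vanishing_pairs p_conv q"
proof -
  have "supp_mod q (- {r}) (euler_phi ^ e)"
    by (rule supp_mod_mono[OF assms(2)]) (use assms in auto)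
  then show ?thesis using assms p_conv_vanishing_iff[OF assms(1,6,3)] by (simp add: vanishing_pairs_def)
qed

lemma sigma_conv_vanishing_pairsI:
  assumes "prime q" "q \<noteq> 3" "0 < k" "k < q" "r < q"
    and "supp_mod q A (fps_XD (euler_phi ^ 3) ^ k * (euler_phi ^ 3) ^ (q - k))" "r \<notin> A"
  shows "(k, r) \<in> vanishing_pairs sigma_conv q"
proof -
  have "supp_mod q (- {r}) (fps_XD (euler_phi ^ 3) ^ k * (euler_phi ^ 3) ^ (q - k))"
    by (rule supp_mod_mono[OF assms(6)]) (use assms in auto)
  then have "\<forall>n. [sigma_conv k (q * n + r) = 0] (mod q)"
    by (intro sigma_conv_vanishing) (use assms in auto)
  then show ?thesis using assms by (simp add: vanishing_pairs_def)
qed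

lemma supp_mod_1: "0 < q \<Longrightarrow> supp_mod q {0} 1"
  by (auto simp: supp_mod_def)

lemma supp_mod_power_singleton:
  assumes "supp_mod q {a} F" "0 < q"
  shows "supp_mod q {k * a mod q} (F ^ k)"
proof (induction k)
  case (Suc k)
  show ?case unfolding power_Suc
    by (rule supp_mod_mult[OF assms(1) Suc assms(2)]) (auto simp: mod_simps)
qed (simp add: supp_mod_1 assms)

text \<open>Reduction modulo \<open>q\<close> never increases an exponent sum, so the upper bounds
  simply add.\<close>

lemma supp_mod_power_atMost:
  assumes "supp_mod q {..a} F" "0 < q"
  shows "supp_mod q {..k * a} (F ^ k)"
proof (induction k)
  case (Suc k)
  have "(x + y) mod q \<in> {..Suc k * a}" if "x \<in> {..a}" "y \<in> {..k * a}" for x y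
    using that order_trans[OF mod_less_eq_dividend[of "x + y" q]] by (simp add: add_mono)
  then show ?case unfolding power_Suc by (intro supp_mod_mult[OF assms(1) Suc assms(2)])
qed (simp add: supp_mod_1 assms)

text \<open>Triangular numbers are 0, 1 or 3 modulo 5, and 3 occurs only when 5 divides
  \<open>2 * k + 1\<close>.\<close>

lemma supp_mod_cube_5: "supp_mod 5 {..1} (euler_phi ^ 3)"
  by (rule supp_mod_euler_phi_cube) (simp_all add: lessThan_nat_numeral)

lemma p_conv_vanishing_pairs_5:
  "vanishing_pairs p_conv 5 = {(1,4), (2,2), (2,3), (2,4), (4,3), (4,4)}"
proof (rule antisym[OF p_conv_vanishing_pairs_subset_5])
  have supp: "supp_mod 5 {..k} (euler_phi ^ (3 * k))" for k
    using supp_mod_power_atMost[OF supp_mod_cube_5, of k] by (simp add: power_mult)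
  \<comment> \<open>For \<open>k = 1, 2, 4\<close> the exponents are 9, 3, 6: multiples of 3
    congruent to \<open>- k\<close> modulo 5.\<close>
  have "(1, r) \<in> vanishing_pairs p_conv 5" if "r < 5" "r \<notin> {..3}" for r
    by (rule p_conv_vanishing_pairsI[OF _ supp, where m = 2]) (use that in simp_all)
  moreover have "(2, r) \<in> vanishing_pairs p_conv 5" if "r < 5" "r \<notin> {..1}" for r
    by (rule p_conv_vanishing_pairsI[OF _ supp, where m = 1]) (use that in simp_all)
  moreover have "(4, r) \<in> vanishing_pairs p_conv 5" if "r < 5" "r \<notin> {..2}" for r
    by (rule p_conv_vanishing_pairsI[OF _ supp, where m = 2]) (use that in simp_all)
  ultimately show "{(1,4), (2,2), (2,3), (2,4), (4,3), (4,4)} \<subseteq> vanishing_pairs p_conv 5"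
    by simp
qed

lemma p_conv_vanishing_pairs_7:
  "vanishing_pairs p_conv 7 = {(1,5), (4,2), (4,4), (4,5), (4,6), (6,3), (6,4), (6,6)}"
proof (rule antisym[OF p_conv_vanishing_pairs_subset_7])
  have phi: "supp_mod 7 {0, 1, 2, 5} (euler_phi ^ 1)"
    unfolding power_one_right by (rule supp_mod_euler_phi) (simp_all add: lessThan_nat_numeral)
  have cube: "supp_mod 7 {0, 1, 3} (euler_phi ^ 3)"
    by (rule supp_mod_euler_phi_cube) (simp_all add: lessThan_nat_numeral)
  \<comment> \<open>Sums of two elements of \<open>{0, 1, 3}\<close> never hit 5 modulo 7.\<close>
  have "supp_mod 7 (- {5}) (euler_phi ^ 3 * euler_phi ^ 3)"
    by (rule supp_mod_mult[OF cube cube]) auto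
  then have six: "supp_mod 7 (- {5}) (euler_phi ^ 6)" by (simp flip: power_add)
  have "(1, r) \<in> vanishing_pairs p_conv 7" if "r < 7" "r \<notin> - {5}" for r
    by (rule p_conv_vanishing_pairsI[OF _ six, where m = 1]) (use that in simp_all)
  moreover have "(4, r) \<in> vanishing_pairs p_conv 7" if "r < 7" "r \<notin> {0, 1, 3}" for r
    by (rule p_conv_vanishing_pairsI[OF _ cube, where m = 1]) (use that in simp_all)
  moreover have "(6, r) \<in> vanishing_pairs p_conv 7" if "r < 7" "r \<notin> {0, 1, 2, 5}" for r
    by (rule p_conv_vanishing_pairsI[OF _ phi, where m = 1]) (use that in simp_all)
  ultimately show "{(1,5), (4,2), (4,4), (4,5), (4,6), (6,3), (6,4), (6,6)} \<subseteq>
      vanishing_pairs p_conv 7"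
    by simp
qed

lemma p_conv_vanishing_pairs_11:
  "vanishing_pairs p_conv 11 =
    {(1,6), (3,7), (5,8), (7,9), (8,2), (8,4), (8,5), (8,7), (8,8), (8,9),
     (10,3), (10,6), (10,8), (10,9), (10,10)}"
proof (rule antisym[OF p_conv_vanishing_pairs_subset_11])
  have phi: "supp_mod 11 {0, 1, 2, 4, 5, 7} (euler_phi ^ 1)"
    unfolding power_one_right by (rule supp_mod_euler_phi) (simp_all add: lessThan_nat_numeral)
  have cube: "supp_mod 11 {0, 1, 3, 6, 10} (euler_phi ^ 3)"
    by (rule supp_mod_euler_phi_cube) (simp_all add: lessThan_nat_numeral)
  \<comment> \<open>Two cube residues never add up to 8 modulo 11; below, a pentagonal and a cube
    residue never add up to 9.\<close>
  have "supp_mod 11 (- {8}) (euler_phi ^ 3 * euler_phi ^ 3)"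
    by (rule supp_mod_mult[OF cube cube]) auto
  then have six: "supp_mod 11 (- {8}) (euler_phi ^ 6)" by (simp flip: power_add)
  have "supp_mod 11 (- {9}) (euler_phi ^ 1 * euler_phi ^ 3)"
    by (rule supp_mod_mult[OF phi cube]) auto
  then have four: "supp_mod 11 (- {9}) (euler_phi ^ 4)" by (simp only: power_add[symmetric]) simp
  \<comment> \<open>For \<open>k = 1\<close> and \<open>k = 3\<close> the exponents are
    \<open>22 - 1 = 3 * 7\<close> and \<open>33 - 3 = 3 * 10\<close>, hence powers of the
    cube.\<close>
  have "(1, r) \<in> vanishing_pairs p_conv 11" if "r < 11" "r \<notin> - {6}" for r
    by (rule p_conv_vanishing_pairsI[OF _ cube_residues_11(1), where m = 2]) (use that in simp_all)
  moreover have "(3, r) \<in> vanishing_pairs p_conv 11" if "r < 11" "r \<notin> - {7}" for r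
    by (rule p_conv_vanishing_pairsI[OF _ cube_residues_11(2), where m = 3]) (use that in simp_all)
  moreover have "(5, r) \<in> vanishing_pairs p_conv 11" if "r < 11" "r \<notin> - {8}" for r
    by (rule p_conv_vanishing_pairsI[OF _ six, where m = 1]) (use that in simp_all)
  moreover have "(7, r) \<in> vanishing_pairs p_conv 11" if "r < 11" "r \<notin> - {9}" for r
    by (rule p_conv_vanishing_pairsI[OF _ four, where m = 1]) (use that in simp_all)
  moreover have "(8, r) \<in> vanishing_pairs p_conv 11" if "r < 11" "r \<notin> {0, 1, 3, 6, 10}" for r
    by (rule p_conv_vanishing_pairsI[OF _ cube, where m = 1]) (use that in simp_all)
  moreover have "(10, r) \<in> vanishing_pairs p_conv 11" if "r < 11" "r \<notin> {0, 1, 2, 4, 5, 7}" for r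
    by (rule p_conv_vanishing_pairsI[OF _ phi, where m = 1]) (use that in simp_all)
  ultimately show "{(1,6), (3,7), (5,8), (7,9), (8,2), (8,4), (8,5), (8,7), (8,8), (8,9),
     (10,3), (10,6), (10,8), (10,9), (10,10)} \<subseteq> vanishing_pairs p_conv 11"
    by simp
qed

lemma p_conv_13_mod_17: "[p_conv 13 (17 * n + 14) = 0] (mod 17)"
proof -
  have phi: "supp_mod 17 {0, 1, 2, 5, 6, 7, 9, 12, 15} (euler_phi ^ 1)"
    unfolding power_one_right by (rule supp_mod_euler_phi) (simp_all add: lessThan_nat_numeral)
  have cube: "supp_mod 17 {0, 1, 3, 4, 6, 10, 11, 15} (euler_phi ^ 3)"
    by (rule supp_mod_euler_phi_cube) (simp_all add: lessThan_nat_numeral)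
  \<comment> \<open>As \<open>13 + 4 = 17\<close>, the fourth power decides; no pentagonal residue
    and cube residue add up to 14 modulo 17.\<close>
  have "supp_mod 17 (- {14}) (euler_phi ^ 1 * euler_phi ^ 3)"
    by (rule supp_mod_mult[OF phi cube]) auto
  then have four: "supp_mod 17 (- {14}) (euler_phi ^ 4)" by (simp only: power_add[symmetric]) simp
  then show ?thesis using p_conv_vanishing_iff[of 17 14 13 4 1] by simp
qed

lemma sigma_conv_vanishing_pairs_5:
  "vanishing_pairs sigma_conv 5 = {(2,1), (3,1), (3,2), (4,1), (4,2), (4,3)}"
proof (rule antisym[OF sigma_conv_vanishing_pairs_subset_5])
  let ?J = "euler_phi ^ 3 :: int fps"
  \<comment> \<open>The cube lives on the classes 0 and 1, and the factor \<open>n\<close> from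
    \<open>fps_XD\<close> removes class 0.\<close>
  have "supp_mod 5 {1} (fps_XD ?J)"
    unfolding supp_mod_def
  proof (intro allI impI)
    fix n :: nat assume n: "n mod 5 \<notin> {1}"
    show "int 5 dvd fps_nth (fps_XD ?J) n"
    proof (cases "n mod 5 = 0")
      case True
      then have "int 5 dvd int n" by presburger
      then show ?thesis by simp
    next
      case False
      then show ?thesis using n supp_mod_cube_5 by (simp add: supp_mod_def)
    qed
  qed
  from supp_mod_power_singleton[OF this] have XD: "supp_mod 5 {k mod 5} (fps_XD ?J ^ k)" for k by simp
  have J: "supp_mod 5 {..k} (?J ^ k)" for k
    using supp_mod_power_atMost[OF supp_mod_cube_5, of k] by simp
  have *: "(k, r) \<in> vanishing_pairs sigma_conv 5" if "0 < r" "r < k" "k < 5" for k r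
  proof (rule sigma_conv_vanishing_pairsI)
    show "supp_mod 5 (- {r}) (fps_XD ?J ^ k * ?J ^ (5 - k))"
    proof (rule supp_mod_mult[OF XD J])
      fix a b assume "a \<in> {k mod 5}" "b \<in> {..5 - k}"
      then have "a = k" "b \<le> 5 - k" using that by auto
      \<comment> \<open>The sum lies between \<open>k\<close> and 5, so its residue is 0 or at least
        \<open>k\<close>, and the classes strictly between are missed.\<close>
      then have "a + b = 5 \<or> (a + b < 5 \<and> k \<le> a + b)" using that by auto
      then show "(a + b) mod 5 \<in> - {r}" using that by auto
    qed simp
  qed (use that in auto)
  show "{(2,1), (3,1), (3,2), (4,1), (4,2), (4,3)} \<subseteq> vanishing_pairs sigma_conv 5"
    by (simp add: *)
qed

lemma sigma_conv_vanishing_pairs_7: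
  "vanishing_pairs sigma_conv 7 = {(2,6), (4,3), (4,6), (5,3)}"
proof (rule antisym[OF sigma_conv_vanishing_pairs_subset_7])
  have "(k, r) \<in> vanishing_pairs sigma_conv 7" if "(k, r) \<in> {(2, 6), (4, 3), (4, 6), (5, 3)}" for k r
    by (rule sigma_conv_vanishing_pairsI[OF _ _ _ _ _ XD_cube_residues_7[OF that]]) (use that in auto)
  then show "{(2,6), (4,3), (4,6), (5,3)} \<subseteq> vanishing_pairs sigma_conv 7" by auto
qed

theorem theorem4p1:
  shows "vanishing_pairs p_conv 5 = {(1,4), (2,2), (2,3), (2,4), (4,3), (4,4)}
    \<and> vanishing_pairs p_conv 7 =
           {(1,5), (4,2), (4,4), (4,5), (4,6), (6,3), (6,4), (6,6)}
    \<and> vanishing_pairs p_conv 11 =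
           {(1,6), (3,7), (5,8), (7,9), (8,2), (8,4), (8,5), (8,7), (8,8), (8,9),
            (10,3), (10,6), (10,8), (10,9), (10,10)}
    \<and> (\<forall>n. [p_conv 13 (17 * n + 14) = 0] (mod 17))
    \<and> vanishing_pairs sigma_conv 5 = {(2,1), (3,1), (3,2), (4,1), (4,2), (4,3)}
    \<and> vanishing_pairs sigma_conv 7 = {(2,6), (4,3), (4,6), (5,3)}"
  by (intro conjI allI p_conv_vanishing_pairs_5 p_conv_vanishing_pairs_7 p_conv_vanishing_pairs_11
      p_conv_13_mod_17 sigma_conv_vanishing_pairs_5 sigma_conv_vanishing_pairs_7)

end
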